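(* Let $X_n^H:=\log|\det W_n^H|-\mu_n^H$ with $\mu_n^H=\frac12\log2\pi-\frac n2+\frac n2\log n$. Let $(a,b)$ be a fixed interval with $a<b$. For every $-\frac12<\delta<1$, $$\lim_{n\to\infty}\left(\frac12\log\left(\frac n2\right)\right)^{\delta+\frac12}\mathbb{P}\left(X_n^H\in\left(\frac2{\log(n/2)}\right)^\delta(a,b)\right)=\frac{b-a}{\sqrt{2\pi}}.$$
   Context: $W_n^H$ is a random $n\times n$ Hermitian matrix of the Gaussian Unitary Ensemble, normalized so that its eigenvalues have joint density on $\mathbb{R}^n$ proportional to $\prod_{1\le j<k\le n}|\lambda_k-\lambda_j|^2\prod_{k=1}^n e^{-\lambda_k^2/2}$. For $c>0$, $c(a,b)$ denotes the interval $(ca,cb)$. *)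

theory Defs
  imports "HOL-Probability.Probability" "Jordan_Normal_Form.Char_Poly"
    "Jordan_Normal_Form.Schur_Decomposition"
begin

text \<open>
  The dimension varies in the limit, so matrices are those of \<open>Jordan_Normal_Form\<close>, whose
  size is a value and whose rows and columns are indexed by \<open>{..<n}\<close>.
\<close>

text \<open>
  The \<open>n\<^sup>2\<close> real coordinates of a Hermitian matrix, indexed by \<open>{..<n} \<times> {..<n}\<close>: the diagonal
  entries at \<open>(i, i)\<close>, and for \<open>i < j\<close> the real part of the entry \<open>(i, j)\<close> at \<open>(i, j)\<close> and its
  imaginary part at \<open>(j, i)\<close>.
\<close>
definition herm_coord :: "complex mat \<Rightarrow> nat \<times> nat \<Rightarrow> real" where
  "herm_coord A = (\<lambda>(i, j). if i \<le> j then Re (A $$ (i, j)) else Im (A $$ (j, i)))"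

text \<open>
  GUE up to scale: law proportional to \<open>exp (- tr A\<^sup>2 / (2 \<sigma>\<^sup>2))\<close> on the Hermitian matrices.
  As \<open>tr A\<^sup>2\<close> counts every off-diagonal entry twice, the real and imaginary parts off the
  diagonal have variance \<open>\<sigma>\<^sup>2 / 2\<close>, the diagonal entries variance \<open>\<sigma>\<^sup>2\<close>.
\<close>
definition gue :: "real \<Rightarrow> nat \<Rightarrow> 'a measure \<Rightarrow> ('a \<Rightarrow> complex mat) \<Rightarrow> bool" where
  "gue \<sigma> n M W \<longleftrightarrow>
     prob_space M \<and>
     (\<forall>\<omega>\<in>space M. W \<omega> \<in> carrier_mat n n \<and> mat_adjoint (W \<omega>) = W \<omega>) \<and>
     prob_space.indep_vars M (\<lambda>_. borel) (\<lambda>p \<omega>. herm_coord (W \<omega>) p) ({..<n} \<times> {..<n}) \<and>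
     (\<forall>i<n. \<forall>j<n. distributed M lborel (\<lambda>\<omega>. herm_coord (W \<omega>) (i, j))
        (normal_density 0 (if i = j then \<sigma> else \<sigma> / sqrt 2)))"

text \<open>
  Joint density on \<open>\<real>\<^sup>n\<close> of the eigenvalues, counted with multiplicity and in no particular
  order: some random vector \<open>\<Lambda>\<close> enumerating them has density \<open>f\<close>. For the GUE and a symmetric
  \<open>f\<close> this does not ask for additional randomness in \<open>M\<close>: the eigenvectors are independent of
  the eigenvalues, and listing the eigenvalues by the modulus of the first coordinate of a unit
  eigenvector gives an exchangeable enumeration.
\<close>
definition eigenvalues_joint_density ::
  "nat \<Rightarrow> 'a measure \<Rightarrow> ('a \<Rightarrow> complex mat) \<Rightarrow> ((nat \<Rightarrow> real) \<Rightarrow> real) \<Rightarrow> bool" where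
  "eigenvalues_joint_density n M W f \<longleftrightarrow>
     (\<exists>\<Lambda>. (\<forall>\<omega>\<in>space M. char_poly (W \<omega>) = (\<Prod>k<n. [:- complex_of_real (\<Lambda> \<omega> k), 1:])) \<and>
          distributed M (Pi\<^sub>M {..<n} (\<lambda>_. lborel)) \<Lambda> (\<lambda>x. ennreal (f x)))"

definition gue_eigen_weight :: "nat \<Rightarrow> (nat \<Rightarrow> real) \<Rightarrow> real" where
  "gue_eigen_weight n x =
     (\<Prod>k<n. \<Prod>j<k. \<bar>x k - x j\<bar>\<^sup>2) * (\<Prod>k<n. exp (- ((x k)\<^sup>2 / 2)))"

text \<open>The eigenvalue density fixes the scale: the two conditions hold together for \<open>\<sigma> = 1\<close> only.\<close>
definition normalized_gue :: "nat \<Rightarrow> 'a measure \<Rightarrow> ('a \<Rightarrow> complex mat) \<Rightarrow> bool" where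
  "normalized_gue n M W \<longleftrightarrow>
     (\<exists>\<sigma>>0. gue \<sigma> n M W) \<and>
     (\<exists>C>0. eigenvalues_joint_density n M W (\<lambda>x. C * gue_eigen_weight n x))"

definition mu_H :: "nat \<Rightarrow> real" where
  "mu_H n = 1/2 * ln (2 * pi) - real n / 2 + real n / 2 * ln (real n)"

text \<open>On the null event \<open>det A = 0\<close> the value is \<open>- mu_H n\<close>, since \<open>ln 0 = 0\<close>.\<close>
definition X_H :: "nat \<Rightarrow> complex mat \<Rightarrow> real" where
  "X_H n A = ln (cmod (Determinant.det A)) - mu_H n"

definition scaled_interval :: "real \<Rightarrow> real \<Rightarrow> real \<Rightarrow> real set" where
  "scaled_interval c a b = {c * a<..<c * b}"

end

theory Submission
  imports Defs "HOL-Real_Asymp.Real_Asymp"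
begin

text \<open>
  The determinant of a GUE matrix is the product of its eigenvalues, so its Mellin transform on the
  imaginary axis is a quotient of two integrals of \<open>\<Delta>(x)\<^sup>2 \<Prod>\<^sub>k w (x\<^sub>k)\<close> with weights
  \<open>w x = \<bar>x\<bar>\<^sup>i\<^sup>t exp (- x\<^sup>2 / 2)\<close>. By Heine's identity (\<open>heine_identity\<close>) such an integral is
  \<open>n!\<close> times the Hankel determinant of the moments of \<open>w\<close>, and that determinant is the product of the
  squared norms of the monic orthogonal polynomials of \<open>w\<close>. For this weight they are the generalized
  Hermite polynomials, whose three-term recurrence is explicit (\<open>det_hankel_hermite\<close>). The outcome
  (\<open>normalized_gue_law\<close>) is that \<open>log \<bar>det W\<bar>\<close> has the law of a sum of \<open>n\<close> independent
  variables: the logarithms of chi variables with \<open>2 (k div 2) + 1\<close> degrees of freedom,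
  \<open>k = 1, \<dots>, n\<close>.

  The variance of the \<open>k\<close>-th summand is about \<open>1 / (2 k)\<close>, so the sum has variance
  \<open>s\<^sup>2 = log (n / 2) / 2\<close> up to a bounded error, and \<open>mu_H n\<close> is its mean up to a bounded error.
  Expanding \<open>log \<Gamma>\<close> to third order shows that the characteristic function of \<open>X / s\<close> tends to that of
  the standard normal law (\<open>normalized_char_tendsto_gaussian\<close>).

  Convergence in law says nothing about intervals whose length, relative to \<open>s\<close>, tends to zero. For
  those it suffices that the characteristic functions of \<open>X / s\<close> have a common integrable majorant:
  then Levy's inversion formula for the interval \<open>\<epsilon> (a, b)\<close>, rescaled by \<open>s / \<epsilon>\<close>, converges by dominated
  convergence to \<open>b - a\<close> times the Gaussian density at the origin (\<open>local_limit_theorem\<close>). The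
  majorant \<open>1 / (1 + (u / 6)\<^sup>2)\<close> comes from the decay of \<open>\<Gamma>\<close> along vertical lines
  (\<open>norm_chi_char_le\<close>): for \<open>k \<ge> 2\<close> the \<open>k\<close>-th factor is at most \<open>1 / (1 + t\<^sup>2 / (36 k))\<close>, and
  multiplying these bounds out leaves a harmonic sum, which is again of the order of \<open>s\<^sup>2\<close>.
\<close>

section \<open>A local limit theorem from dominated characteristic functions\<close>

text \<open>
  The Fourier transform of the indicator of \<open>{a<..b}\<close>, as it appears in Levy's inversion formula; at
  \<open>t = 0\<close> it takes the junk value \<open>0\<close> instead of \<open>b - a\<close>.
\<close>
definition levy_kernel :: "real \<Rightarrow> real \<Rightarrow> real \<Rightarrow> complex" where
  "levy_kernel a b t = (iexp (- (t * a)) - iexp (- (t * b))) / (\<i> * t)"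

lemma levy_kernel_measurable [measurable]: "levy_kernel a b \<in> borel_measurable borel"
  unfolding levy_kernel_def by measurable

lemma norm_levy_kernel_le:
  assumes "a \<le> b"
  shows "norm (levy_kernel a b t) \<le> b - a"
proof (cases "t = 0")
  case False
  then show ?thesis
    using Levy_Inversion_aux2[of "-b" "-a" t] assms by (simp add: levy_kernel_def)
qed (use assms in \<open>simp add: levy_kernel_def\<close>)

lemma levy_kernel_scale:
  assumes "c \<noteq> 0"
  shows "levy_kernel (c * a) (c * b) t = c * levy_kernel a b (c * t)"
proof -
  have *: "t * (c * x) = c * t * x" for x
    by (simp add: mult_ac)
  have **: "X / (\<i> * of_real t) = of_real c * (X / (\<i> * of_real (c * t)))" for X :: complex
    using assms by simp
  show ?thesis
    unfolding levy_kernel_def * by (rule **)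
qed

text \<open>
  Levy's formula gives the measure as an improper integral; integrability of the characteristic
  function turns it into a Lebesgue integral, to which dominated convergence can be applied.
\<close>
lemma (in real_distribution) measure_eq_integral_char:
  fixes a b :: real
  assumes ab: "a \<le> b" and atoms: "measure M {a} = 0" "measure M {b} = 0"
    and int: "integrable lborel (char M)"
  shows "complex_of_real (measure M {a<..b}) =
           1 / (2 * pi) * (\<integral>t. levy_kernel a b t * char M t \<partial>lborel)"
proof -
  define f where "f t = levy_kernel a b t * char M t" for t
  have [measurable]: "char M \<in> borel_measurable lborel"
    using int by auto
  have f_int: "integrable lborel f"
    unfolding f_def
  proof (rule Bochner_Integration.integrable_bound[OF integrable_mult_right[OF int, of "of_real (b - a)"]])
    show "AE t in lborel. norm (levy_kernel a b t * char M t) \<le> norm (of_real (b - a) * char M t)"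
      using ab by (intro AE_I2) (simp add: norm_mult mult_right_mono norm_levy_kernel_le del: of_real_diff)
  qed measurable
  have lim1: "(\<lambda>n. 1 / (2 * pi) * (\<integral>t. indicator {- real n<..<real n} t *\<^sub>R f t \<partial>lborel))
      \<longlonglongrightarrow> 1 / (2 * pi) * (\<integral>t. f t \<partial>lborel)"
  proof (intro tendsto_intros integral_dominated_convergence[where w="\<lambda>t. norm (f t)"])
    show "AE t in lborel. (\<lambda>n. indicator {- real n<..<real n} t *\<^sub>R f t) \<longlonglongrightarrow> f t"
    proof (rule AE_I2)
      fix t :: real
      have "\<forall>\<^sub>F n in sequentially. \<bar>t\<bar> < real n"
        using filterlim_real_sequentially by (simp add: filterlim_at_top_dense)
      then have "\<forall>\<^sub>F n in sequentially. f t = indicator {- real n<..<real n} t *\<^sub>R f t"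
        by eventually_elim (auto simp: indicator_def)
      then show "(\<lambda>n. indicator {- real n<..<real n} t *\<^sub>R f t) \<longlonglongrightarrow> f t"
        by (rule tendsto_eventually[OF eventually_mono]) auto
    qed
    show "integrable lborel (\<lambda>t. norm (f t))"
      using f_int by (rule integrable_norm)
    show "f \<in> borel_measurable lborel"
      using f_int by auto
    then show "(\<lambda>t. indicator {- real n<..<real n} t *\<^sub>R f t) \<in> borel_measurable lborel" for n
      by measurable
    show "AE t in lborel. norm (indicator {- real n<..<real n} t *\<^sub>R f t) \<le> norm (f t)" for n
      by (auto simp: indicator_def)
  qed
  have "(\<lambda>n. 1 / (2 * pi) * (\<integral>t. indicator {- real n<..<real n} t *\<^sub>R f t \<partial>lborel))
      \<longlonglongrightarrow> complex_of_real (measure M {a<..b})"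
    using Levy_Inversion[OF ab atoms]
    by (simp add: interval_lebesgue_integral_def set_lebesgue_integral_def f_def levy_kernel_def)
  from LIMSEQ_unique[OF this lim1] show ?thesis
    by (simp add: f_def)
qed

lemma exists_outside_countable:
  fixes c d :: real
  assumes "countable C" "c < d"
  shows "\<exists>x. c < x \<and> x < d \<and> x \<notin> C"
proof (rule ccontr)
  assume "\<not> ?thesis"
  then have "{c<..<d} \<subseteq> C" by auto
  then show False
    using assms uncountable_open_interval countable_subset by blast
qed

text \<open>
  After the substitution \<open>t = u / s\<close> the kernel depends on \<open>u\<close> only through \<open>\<epsilon> / s * u\<close>, which tends to
  zero. Hence the kernel tends to \<open>b - a\<close>, and what remains is the integral of the limiting
  characteristic function, \<open>\<integral> exp (- u\<^sup>2 / 2) = sqrt (2 \<pi>)\<close>.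
\<close>
lemma local_limit_half_open:
  fixes N :: "nat \<Rightarrow> real measure" and s \<epsilon> :: "nat \<Rightarrow> real" and g :: "real \<Rightarrow> real"
  assumes dist: "\<forall>\<^sub>F n in sequentially. real_distribution (N n)"
    and s_pos: "\<forall>\<^sub>F n in sequentially. s n > 0"
    and eps_pos: "\<forall>\<^sub>F n in sequentially. \<epsilon> n > 0"
    and eps_small: "(\<lambda>n. \<epsilon> n / s n) \<longlonglongrightarrow> 0"
    and char_lim: "\<And>u. (\<lambda>n. char (N n) (u / s n)) \<longlonglongrightarrow> of_real (exp (- (u\<^sup>2 / 2)))"
    and g: "integrable lborel g"
    and bound: "\<forall>\<^sub>F n in sequentially. \<forall>u. norm (char (N n) (u / s n)) \<le> g u"
    and ab: "a < b"
    and atoms: "\<forall>\<^sub>F n in sequentially. measure (N n) {\<epsilon> n * a} = 0 \<and> measure (N n) {\<epsilon> n * b} = 0"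
  shows "(\<lambda>n. s n / \<epsilon> n * measure (N n) {\<epsilon> n * a<..\<epsilon> n * b}) \<longlonglongrightarrow> (b - a) / sqrt (2 * pi)"
proof -
  define h where "h n u = levy_kernel a b (\<epsilon> n / s n * u) * char (N n) (u / s n)" for n u
  have "\<forall>\<^sub>F n in sequentially. real_distribution (N n) \<and> s n > 0 \<and> \<epsilon> n > 0 \<and>
      (\<forall>u. norm (char (N n) (u / s n)) \<le> g u) \<and> measure (N n) {\<epsilon> n * a} = 0 \<and> measure (N n) {\<epsilon> n * b} = 0"
    using dist s_pos eps_pos bound atoms by eventually_elim auto
  then obtain n0 where n0: "\<And>n. n \<ge> n0 \<Longrightarrow> real_distribution (N n) \<and> s n > 0 \<and> \<epsilon> n > 0 \<and>
      (\<forall>u. norm (char (N n) (u / s n)) \<le> g u) \<and> measure (N n) {\<epsilon> n * a} = 0 \<and> measure (N n) {\<epsilon> n * b} = 0"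
    unfolding eventually_sequentially by blast
  have char_meas: "(\<lambda>u. char (N n) (u / s n)) \<in> borel_measurable lborel" if "n \<ge> n0" for n
  proof -
    interpret real_distribution "N n" using n0 that by blast
    note char_measurable[measurable]
    show ?thesis by measurable
  qed
  have repr: "complex_of_real (s n / \<epsilon> n * measure (N n) {\<epsilon> n * a<..\<epsilon> n * b}) =
      1 / (2 * pi) * (\<integral>u. h n u \<partial>lborel)" if n: "n \<ge> n0" for n
  proof -
    interpret real_distribution "N n" using n0 n by blast
    have pos: "s n > 0" "\<epsilon> n > 0" and bd: "\<And>u. norm (char (N n) (u / s n)) \<le> g u"
      using n0[OF n] by auto
    have "integrable lborel (\<lambda>u. char (N n) (u / s n))"
    proof (rule Bochner_Integration.integrable_bound[OF g char_meas[OF n]])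
      show "AE u in lborel. norm (char (N n) (u / s n)) \<le> norm (g u)"
      proof (intro AE_I2)
        show "norm (char (N n) (u / s n)) \<le> norm (g u)" for u
          using bd[of u] by simp
      qed
    qed
    then have int: "integrable lborel (char (N n))"
      using lborel_integrable_real_affine_iff[of "1 / s n" "char (N n)" 0] pos by simp
    have "complex_of_real (measure (N n) {\<epsilon> n * a<..\<epsilon> n * b}) =
        1 / (2 * pi) * (\<integral>t. levy_kernel (\<epsilon> n * a) (\<epsilon> n * b) t * char (N n) t \<partial>lborel)"
      by (rule measure_eq_integral_char) (use ab pos n0[OF n] int in auto)
    also have "(\<integral>t. levy_kernel (\<epsilon> n * a) (\<epsilon> n * b) t * char (N n) t \<partial>lborel) =
        (1 / s n) *\<^sub>R (\<integral>u. levy_kernel (\<epsilon> n * a) (\<epsilon> n * b) (u / s n) * char (N n) (u / s n) \<partial>lborel)"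
      by (subst lborel_integral_real_affine[where c = "1 / s n" and t = 0]) (use pos in auto)
    also have "(\<lambda>u. levy_kernel (\<epsilon> n * a) (\<epsilon> n * b) (u / s n) * char (N n) (u / s n)) =
        (\<lambda>u. of_real (\<epsilon> n) * h n u)"
      using pos by (auto simp: levy_kernel_scale h_def)
    finally show ?thesis
      using pos by (simp add: scaleR_conv_of_real)
  qed
  have tail: "(\<lambda>n. \<integral>u. h (n + n0) u \<partial>lborel)
      \<longlonglongrightarrow> (\<integral>u. of_real (b - a) * of_real (exp (- (u\<^sup>2 / 2))) \<partial>lborel)"
  proof (rule integral_dominated_convergence[where w = "\<lambda>u. (b - a) * g u"])
    show "AE u in lborel. (\<lambda>n. h (n + n0) u) \<longlonglongrightarrow> of_real (b - a) * of_real (exp (- (u\<^sup>2 / 2)))"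
    proof (rule AE_I[where N = "{0}"])
      show "{u \<in> space lborel. \<not> (\<lambda>n. h (n + n0) u) \<longlonglongrightarrow> of_real (b - a) * of_real (exp (- (u\<^sup>2 / 2)))} \<subseteq> {0}"
      proof safe
        fix u :: real
        assume no: "\<not> (\<lambda>n. h (n + n0) u) \<longlonglongrightarrow> of_real (b - a) * of_real (exp (- (u\<^sup>2 / 2)))"
        show "u = 0"
        proof (rule ccontr)
          assume u: "u \<noteq> 0"
          have "\<forall>\<^sub>F n in sequentially. \<epsilon> n / s n * u \<noteq> 0"
            using s_pos eps_pos by eventually_elim (use u in auto)
          then have "filterlim (\<lambda>n. \<epsilon> n / s n * u) (at 0) sequentially"
            using tendsto_mult_right[OF eps_small, of u] unfolding filterlim_at by auto
          from filterlim_compose[OF Levy_Inversion_aux1[of a b] this]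
          have "(\<lambda>n. levy_kernel a b (\<epsilon> n / s n * u)) \<longlonglongrightarrow> of_real (b - a)"
            using ab by (simp add: levy_kernel_def)
          from tendsto_mult[OF this char_lim[of u]]
          have "(\<lambda>n. h n u) \<longlonglongrightarrow> of_real (b - a) * of_real (exp (- (u\<^sup>2 / 2)))"
            by (simp add: h_def)
          from LIMSEQ_ignore_initial_segment[OF this, of n0] no show False by contradiction
        qed
      qed
    qed auto
    show "integrable lborel (\<lambda>u. (b - a) * g u)" using g by simp
    show "(\<lambda>u. h (n + n0) u) \<in> borel_measurable lborel" for n
      using char_meas[of "n + n0"] unfolding h_def by measurable
    show "AE u in lborel. norm (h (n + n0) u) \<le> (b - a) * g u" for n
      using n0[of "n + n0"] ab
      by (intro AE_I2) (auto simp: h_def norm_mult intro!: mult_mono norm_levy_kernel_le)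
  qed measurable
  have "(\<integral>u. exp (- (u\<^sup>2 / 2)) \<partial>lborel) = sqrt (2 * pi)"
  proof -
    have "(\<integral>u. std_normal_density u \<partial>lborel) = 1"
      using integral_std_normal_moment_even[of 0] by simp
    then show ?thesis
      by (simp add: std_normal_density_def field_simps)
  qed
  then have gauss: "(\<integral>u. of_real (b - a) * of_real (exp (- (u\<^sup>2 / 2))) \<partial>lborel) =
      complex_of_real ((b - a) * sqrt (2 * pi))"
    by simp
  have "1 / (2 * pi) * ((b - a) * sqrt (2 * pi)) = (b - a) / sqrt (2 * pi)"
    by (simp add: field_simps)
  then have val: "complex_of_real (1 / (2 * pi)) * complex_of_real ((b - a) * sqrt (2 * pi)) =
      complex_of_real ((b - a) / sqrt (2 * pi))"
    by (metis of_real_mult)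
  have "(\<lambda>n. complex_of_real (s n / \<epsilon> n * measure (N n) {\<epsilon> n * a<..\<epsilon> n * b}))
      \<longlonglongrightarrow> complex_of_real ((b - a) / sqrt (2 * pi))"
  proof (rule LIMSEQ_offset[where k = n0])
    show "(\<lambda>n. complex_of_real (s (n + n0) / \<epsilon> (n + n0) *
          measure (N (n + n0)) {\<epsilon> (n + n0) * a<..\<epsilon> (n + n0) * b}))
        \<longlonglongrightarrow> complex_of_real ((b - a) / sqrt (2 * pi))"
      using tendsto_mult[OF tendsto_const[of "complex_of_real (1 / (2 * pi))"] tail[unfolded gauss]]
      by (subst repr) (simp_all only: val le_add2)
  qed
  then show ?thesis
    unfolding tendsto_of_real_iff .
qed

text \<open>
  All the laws together have countably many atoms. So \<open>a\<close> and \<open>b\<close> can be moved slightly, inwards or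
  outwards, to points whose multiples by every \<open>\<epsilon> n\<close> are not atoms, and the open interval is squeezed
  between two half-open ones.
\<close>
theorem local_limit_theorem:
  fixes N :: "nat \<Rightarrow> real measure" and s \<epsilon> :: "nat \<Rightarrow> real" and g :: "real \<Rightarrow> real"
  assumes dist: "\<forall>\<^sub>F n in sequentially. real_distribution (N n)"
    and s_pos: "\<forall>\<^sub>F n in sequentially. s n > 0"
    and eps_pos: "\<forall>\<^sub>F n in sequentially. \<epsilon> n > 0"
    and eps_small: "(\<lambda>n. \<epsilon> n / s n) \<longlonglongrightarrow> 0"
    and char_lim: "\<And>u. (\<lambda>n. char (N n) (u / s n)) \<longlonglongrightarrow> of_real (exp (- (u\<^sup>2 / 2)))"
    and g: "integrable lborel g"
    and bound: "\<forall>\<^sub>F n in sequentially. \<forall>u. norm (char (N n) (u / s n)) \<le> g u"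
    and ab: "a < b"
  shows "(\<lambda>n. s n / \<epsilon> n * measure (N n) {\<epsilon> n * a<..<\<epsilon> n * b}) \<longlonglongrightarrow> (b - a) / sqrt (2 * pi)"
proof -
  \<comment> \<open>The points whose multiples by some \<open>\<epsilon> n\<close> are atoms.\<close>
  define C where "C = (\<Union>n\<in>{n. real_distribution (N n) \<and> \<epsilon> n > 0}. {x. measure (N n) {\<epsilon> n * x} \<noteq> 0})"
  have "countable C"
    unfolding C_def
  proof (intro countable_UN)
    fix n assume n: "n \<in> {n. real_distribution (N n) \<and> \<epsilon> n > 0}"
    then interpret real_distribution "N n" by auto
    have "{x. measure (N n) {\<epsilon> n * x} \<noteq> 0} \<subseteq> (\<lambda>y. y / \<epsilon> n) ` {y. measure (N n) {y} \<noteq> 0}"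
      using n by (auto simp: image_iff intro!: exI[of _ "\<epsilon> n * _"])
    then show "countable {x. measure (N n) {\<epsilon> n * x} \<noteq> 0}"
      using countable_support countable_image countable_subset by blast
  qed auto
  have half_open: "(\<lambda>n. s n / \<epsilon> n * measure (N n) {\<epsilon> n * c<..\<epsilon> n * d}) \<longlonglongrightarrow> (d - c) / sqrt (2 * pi)"
    if "c < d" "c \<notin> C" "d \<notin> C" for c d
  proof (rule local_limit_half_open[OF dist s_pos eps_pos eps_small char_lim g bound \<open>c < d\<close>])
    show "\<forall>\<^sub>F n in sequentially. measure (N n) {\<epsilon> n * c} = 0 \<and> measure (N n) {\<epsilon> n * d} = 0"
      using dist eps_pos by eventually_elim (use that in \<open>auto simp: C_def\<close>)
  qed
  have mono: "\<forall>\<^sub>F n in sequentially. A n \<subseteq> B n \<longrightarrow> B n \<in> sets borel \<longrightarrow>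
      s n / \<epsilon> n * measure (N n) (A n) \<le> s n / \<epsilon> n * measure (N n) (B n)" for A B
    using dist s_pos eps_pos
  proof eventually_elim
    case (elim n)
    then interpret real_distribution "N n" by auto
    show ?case using elim
      by (auto intro!: mult_left_mono finite_measure_mono divide_right_mono)
  qed
  show ?thesis
  proof (rule order_tendstoI)
    fix y assume y: "y < (b - a) / sqrt (2 * pi)"
    then have y': "y * sqrt (2 * pi) < b - a" by (simp add: field_simps)
    define \<theta> where "\<theta> = min ((b - a) / 2) ((b - a - y * sqrt (2 * pi)) / 2)"
    have "\<theta> \<le> (b - a) / 2" "\<theta> \<le> (b - a - y * sqrt (2 * pi)) / 2"
      unfolding \<theta>_def by (rule min.cobounded1, rule min.cobounded2)
    moreover have "\<theta> > 0" using y' ab by (simp add: \<theta>_def)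
    ultimately have th: "\<theta> > 0" "2 * \<theta> \<le> b - a" "2 * \<theta> \<le> b - a - y * sqrt (2 * pi)"
      by simp_all
    obtain c d where cd: "a < c" "c < a + \<theta>" "c \<notin> C" "b - \<theta> < d" "d < b" "d \<notin> C"
      using exists_outside_countable[OF \<open>countable C\<close>, of a "a + \<theta>"]
        exists_outside_countable[OF \<open>countable C\<close>, of "b - \<theta>" b] th by auto
    have "c < d" using cd th by linarith
    have "y * sqrt (2 * pi) < d - c" using cd th by linarith
    then have "y < (d - c) / sqrt (2 * pi)" by (simp add: field_simps)
    from order_tendstoD(1)[OF half_open[OF \<open>c < d\<close> \<open>c \<notin> C\<close> \<open>d \<notin> C\<close>] this]
      mono[of "\<lambda>n. {\<epsilon> n * c<..\<epsilon> n * d}" "\<lambda>n. {\<epsilon> n * a<..<\<epsilon> n * b}"] eps_pos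
    show "\<forall>\<^sub>F n in sequentially. y < s n / \<epsilon> n * measure (N n) {\<epsilon> n * a<..<\<epsilon> n * b}"
    proof eventually_elim
      case (elim n)
      have "\<epsilon> n * a \<le> \<epsilon> n * c" "\<epsilon> n * d < \<epsilon> n * b"
        using elim cd by (auto intro: mult_strict_left_mono)
      then have "{\<epsilon> n * c<..\<epsilon> n * d} \<subseteq> {\<epsilon> n * a<..<\<epsilon> n * b}" by auto
      then show ?case using elim by auto
    qed
  next
    fix y assume y: "y > (b - a) / sqrt (2 * pi)"
    define \<theta> where "\<theta> = (y * sqrt (2 * pi) - (b - a)) / 2"
    have th: "\<theta> > 0" using y by (auto simp: \<theta>_def field_simps)
    obtain c d where cd: "a - \<theta> < c" "c < a" "c \<notin> C" "b < d" "d < b + \<theta>" "d \<notin> C"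
      using exists_outside_countable[OF \<open>countable C\<close>, of "a - \<theta>" a]
        exists_outside_countable[OF \<open>countable C\<close>, of b "b + \<theta>"] th by auto
    have "c < d" using cd ab by linarith
    have "d - c < y * sqrt (2 * pi)" using cd by (auto simp: \<theta>_def field_simps)
    then have "(d - c) / sqrt (2 * pi) < y" by (simp add: field_simps)
    from order_tendstoD(2)[OF half_open[OF \<open>c < d\<close> \<open>c \<notin> C\<close> \<open>d \<notin> C\<close>] this]
      mono[of "\<lambda>n. {\<epsilon> n * a<..<\<epsilon> n * b}" "\<lambda>n. {\<epsilon> n * c<..\<epsilon> n * d}"] eps_pos
    show "\<forall>\<^sub>F n in sequentially. s n / \<epsilon> n * measure (N n) {\<epsilon> n * a<..<\<epsilon> n * b} < y"
    proof eventually_elim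
      case (elim n)
      have "\<epsilon> n * c \<le> \<epsilon> n * a" "\<epsilon> n * b \<le> \<epsilon> n * d"
        using elim cd by (auto intro: mult_left_mono)
      then have "{\<epsilon> n * a<..<\<epsilon> n * b} \<subseteq> {\<epsilon> n * c<..\<epsilon> n * d}" by auto
      then show ?case using elim by auto
    qed
  qed
qed

section \<open>Logarithms of chi variables\<close>

text \<open>
  Comparing the defining series termwise bounds the third derivative of \<open>log \<Gamma>\<close> by the second one.
  Thus the third-order error of the whole product is controlled by its variance.
\<close>
lemma norm_Polygamma2_le:
  fixes x :: real and z :: complex
  assumes "x > 0" "Re z \<ge> x"
  shows "norm (Polygamma 2 z) \<le> 2 / x * Polygamma 1 x"
proof -
  have x_k: "x + real k > 0" for k using assms by linarith
  have le: "norm (inverse ((z + of_nat k) ^ 3)) \<le> 1 / x * inverse ((x + of_nat k) ^ 2)" for k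
  proof -
    have "x + real k \<le> norm (z + of_nat k)"
      using complex_Re_le_cmod[of "z + of_nat k"] assms by simp
    then have "(x + real k) ^ 3 \<le> norm (z + of_nat k) ^ 3"
      using x_k[of k] by (intro power_mono) auto
    moreover have "x * (x + real k) ^ 2 \<le> (x + real k) ^ 3"
      using x_k[of k] unfolding power3_eq_cube power2_eq_square mult.assoc[symmetric]
      by (intro mult_right_mono) auto
    ultimately have "x * (x + real k) ^ 2 \<le> norm (z + of_nat k) ^ 3"
      by (rule order_trans[rotated])
    moreover have "x * (x + real k) ^ 2 > 0" using x_k[of k] assms by simp
    ultimately have "inverse (norm (z + of_nat k) ^ 3) \<le> inverse (x * (x + real k) ^ 2)"
      by (rule le_imp_inverse_le)
    moreover have "norm (inverse ((z + of_nat k) ^ 3)) = inverse (norm (z + of_nat k) ^ 3)"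
      unfolding norm_inverse norm_power ..
    ultimately show ?thesis by (simp add: inverse_eq_divide)
  qed
  have sum2: "summable (\<lambda>k. inverse ((x + of_nat k) ^ 2))"
    using assms by (intro Polygamma_converges') auto
  have "norm (\<Sum>k. inverse ((z + of_nat k) ^ 3)) \<le> (\<Sum>k. 1 / x * inverse ((x + of_nat k) ^ 2))"
    by (intro norm_suminf_le le summable_mult sum2)
  also have "\<dots> = 1 / x * Polygamma 1 x"
    using suminf_mult[OF sum2, of "1 / x"] by (simp add: Polygamma_def power2_eq_square)
  finally show ?thesis
    by (simp add: Polygamma_def norm_mult numeral_3_eq_3 numeral_2_eq_2)
qed

lemma ln_Gamma_imaginary_Taylor:
  fixes x y :: real
  assumes x: "x > 0"
  shows "norm (ln_Gamma (Complex x y) - (ln_Gamma (of_real x) + \<i> * of_real (y * Digamma x)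
           - of_real (y\<^sup>2 / 2 * Polygamma 1 x))) \<le> \<bar>y\<bar> ^ 3 / x * Polygamma 1 x"
proof -
  define f :: "nat \<Rightarrow> complex \<Rightarrow> complex" where
    "f i = (case i of 0 \<Rightarrow> ln_Gamma | Suc j \<Rightarrow> Polygamma j)" for i
  define S where "S = {z. Re z \<ge> x}"
  have Taylor: "norm (f 0 (Complex x y) - (\<Sum>i\<le>2. f i (of_real x) * (Complex x y - of_real x) ^ i / fact i))
      \<le> (2 / x * Polygamma 1 x) * norm (Complex x y - of_real x) ^ Suc 2 / fact 2"
  proof (rule field_Taylor)
    show "convex S" unfolding S_def by (rule convex_halfspace_Re_ge)
    show "(f i has_field_derivative f (Suc i) z) (at z within S)" if "z \<in> S" "i \<le> 2" for i z
    proof (cases i)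
      case 0
      have "z \<notin> \<real>\<^sub>\<le>\<^sub>0" using that x by (auto simp: S_def complex_nonpos_Reals_iff)
      then show ?thesis
        unfolding 0 f_def by (auto intro: has_field_derivative_at_within has_field_derivative_ln_Gamma_complex)
    next
      case (Suc j)
      have "z \<notin> \<int>\<^sub>\<le>\<^sub>0" using that x by (auto simp: S_def elim!: nonpos_Ints_cases)
      then show ?thesis
        unfolding Suc f_def by (auto intro: has_field_derivative_Polygamma)
    qed
    show "norm (f (Suc 2) z) \<le> 2 / x * Polygamma 1 x" if "z \<in> S" for z
      using norm_Polygamma2_le[OF x, of z] that by (auto simp: f_def S_def numeral_2_eq_2)
  qed (use x in \<open>auto simp: S_def\<close>)
  have diff: "Complex x y - of_real x = \<i> * of_real y"
    by (simp add: complex_eq_iff)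
  have poly: "(\<Sum>i\<le>2. f i (of_real x) * (\<i> * of_real y) ^ i / fact i) =
      ln_Gamma (of_real x) + \<i> * of_real (y * Digamma x) - of_real (y\<^sup>2 / 2 * Polygamma 1 x)"
    using x by (simp add: numeral_2_eq_2 f_def Polygamma_of_real power2_eq_square algebra_simps)
  have "norm (f 0 (Complex x y) - (ln_Gamma (of_real x) + \<i> * of_real (y * Digamma x)
           - of_real (y\<^sup>2 / 2 * Polygamma 1 x))) \<le> (2 / x * Polygamma 1 x) * \<bar>y\<bar> ^ 3 / 2"
    using Taylor unfolding diff poly by (simp add: norm_mult numeral_3_eq_3)
  then show ?thesis
    by (simp add: f_def mult_ac)
qed

text \<open>
  The characteristic function of the logarithm of a chi variable with \<open>2 m + 1\<close> degrees of freedom.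
\<close>
definition chi_char :: "nat \<Rightarrow> real \<Rightarrow> complex" where
  "chi_char m t = exp (\<i> * of_real (t / 2 * ln 2)) *
     Gamma (Complex (real m + 1/2) (t / 2)) / Gamma (of_real (real m + 1/2))"

text \<open>
  The factors of \<open>z (z + 1) \<dots> (z + n)\<close> only grow in modulus when an imaginary part is added to \<open>Re z\<close>,
  and Euler's limit formula has this product in the denominator.
\<close>
lemma norm_Gamma_le:
  assumes "Re z > 0"
  shows "norm (Gamma z) \<le> Gamma (Re z)"
proof (rule LIMSEQ_le)
  show "(\<lambda>n. norm (Gamma_series z n)) \<longlonglongrightarrow> norm (Gamma z)"
    by (intro tendsto_norm Gamma_series_LIMSEQ)
  show "Gamma_series (Re z) \<longlonglongrightarrow> Gamma (Re z)"
    by (rule Gamma_series_LIMSEQ)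
  have "norm (Gamma_series z n) \<le> Gamma_series (Re z) n" for n
  proof -
    have "pochhammer (Re z) (n + 1) \<le> norm (pochhammer z (n + 1))"
      unfolding pochhammer_prod prod_norm[symmetric]
    proof (intro prod_mono conjI)
      fix i
      show "0 \<le> Re z + of_nat i" using assms by simp
      show "Re z + of_nat i \<le> norm (z + of_nat i)"
        using complex_Re_le_cmod[of "z + of_nat i"] by simp
    qed
    moreover have "pochhammer (Re z) (n + 1) > 0"
      using assms by (rule pochhammer_pos)
    ultimately show ?thesis
      unfolding Gamma_series_def norm_divide norm_mult
      by (intro frac_le) (auto simp: mult_mono)
  qed
  then show "\<exists>N. \<forall>n\<ge>N. norm (Gamma_series z n) \<le> Gamma_series (Re z) n" by blast
qed

lemma norm_chi_char:
  "norm (chi_char m t) = norm (Gamma (Complex (real m + 1/2) (t / 2))) / Gamma (real m + 1/2)"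
proof -
  have "Gamma (real m + 1/2) > 0" by (rule Gamma_real_pos) simp
  then show ?thesis
    unfolding chi_char_def Gamma_complex_of_real
    by (simp add: norm_mult norm_divide)
qed

lemma norm_chi_char_le_1: "norm (chi_char m t) \<le> 1"
proof -
  have "Gamma (real m + 1/2) > 0" by (rule Gamma_real_pos) simp
  then show ?thesis
    using norm_Gamma_le[of "Complex (real m + 1/2) (t / 2)"]
    by (simp add: norm_chi_char divide_le_eq)
qed

text \<open>
  Moving the argument of \<open>\<Gamma>\<close> to the right by \<open>2 m\<close> gains the factors \<open>(x + j) / \<bar>z + j\<bar>\<close>, \<open>j < 2 m\<close>,
  where \<open>z = x + \<i> t / 2\<close> and \<open>x = m + 1/2\<close>. Since \<open>x + j \<le> 3 m\<close>, the inverse of each is at least \<open>sqrt (1 + t\<^sup>2 / (36 m\<^sup>2))\<close>. With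
  \<open>2 m\<close> factors the square root disappears, and Bernoulli's inequality gives \<open>1 + t\<^sup>2 / (36 m)\<close>.
\<close>
lemma norm_chi_char_le:
  assumes m: "m \<ge> 1"
  shows "norm (chi_char m t) \<le> 1 / (1 + t\<^sup>2 / (36 * real m))"
proof -
  define x where "x = real m + 1/2"
  define z where "z = Complex x (t / 2)"
  define c where "c = t\<^sup>2 / (36 * (real m)\<^sup>2)"
  have x: "x > 0" by (simp add: x_def)
  have c: "c \<ge> 0" by (simp add: c_def)
  have z_notin: "z \<notin> \<int>\<^sub>\<le>\<^sub>0" "x \<notin> \<int>\<^sub>\<le>\<^sub>0"
    using x by (auto simp: z_def complex_eq_iff elim!: nonpos_Ints_cases)
  have Gz: "Gamma z \<noteq> 0" using z_notin by (simp add: Gamma_eq_zero_iff)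
  have Gx: "Gamma x > 0" using x by (rule Gamma_real_pos)
  have px: "pochhammer x (2 * m) > 0" using x by (rule pochhammer_pos)
  have factor: "((x + real i) * sqrt (1 + c)) \<le> norm (z + of_nat i)" if "i < 2 * m" for i
  proof -
    have "x + real i \<le> 3 * real m" using that by (simp add: x_def)
    then have "(x + real i)\<^sup>2 \<le> (3 * real m)\<^sup>2" using x by (intro power_mono) auto
    then have "(x + real i)\<^sup>2 * c \<le> (3 * real m)\<^sup>2 * c" using c by (rule mult_right_mono)
    also have "\<dots> = (t / 2)\<^sup>2" using m by (simp add: c_def field_simps)
    finally have "(x + real i)\<^sup>2 * (1 + c) \<le> (x + real i)\<^sup>2 + (t / 2)\<^sup>2"
      by (simp add: algebra_simps)
    then have "sqrt ((x + real i)\<^sup>2 * (1 + c)) \<le> norm (z + of_nat i)"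
      unfolding cmod_def by (intro real_sqrt_le_mono) (simp add: z_def)
    then show ?thesis using x by (simp add: real_sqrt_mult)
  qed
  have "pochhammer x (2 * m) * (1 + c) ^ m = (\<Prod>i = 0..<2 * m. (x + real i) * sqrt (1 + c))"
    using c by (simp add: pochhammer_prod prod.distrib power_mult)
  also have "\<dots> \<le> (\<Prod>i = 0..<2 * m. norm (z + of_nat i))"
    using x c by (intro prod_mono conjI factor) auto
  also have "\<dots> = norm (pochhammer z (2 * m))"
    by (simp add: pochhammer_prod prod_norm)
  finally have poch: "pochhammer x (2 * m) * (1 + c) ^ m \<le> norm (pochhammer z (2 * m))" .
  have "1 + t\<^sup>2 / (36 * real m) = 1 + real m * c"
    using m by (simp add: c_def power2_eq_square)
  also have "\<dots> \<le> (1 + c) ^ m"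
    using c by (intro Bernoulli_inequality) auto
  finally have bern: "1 + t\<^sup>2 / (36 * real m) \<le> (1 + c) ^ m" .
  have "norm (Gamma (z + of_nat (2 * m))) \<le> Gamma (x + of_nat (2 * m))"
    using norm_Gamma_le[of "z + of_nat (2 * m)"] x by (simp add: z_def)
  moreover have "Gamma (z + of_nat (2 * m)) = pochhammer z (2 * m) * Gamma z"
    using pochhammer_Gamma[OF z_notin(1), of "2 * m"] Gz by simp
  moreover have "Gamma (x + of_nat (2 * m)) = pochhammer x (2 * m) * Gamma x"
    using pochhammer_Gamma[OF z_notin(2), of "2 * m"] Gx by simp
  ultimately have "norm (pochhammer z (2 * m)) * norm (Gamma z) \<le> pochhammer x (2 * m) * Gamma x"
    by (simp add: norm_mult)
  with poch have "pochhammer x (2 * m) * (1 + c) ^ m * norm (Gamma z) \<le> pochhammer x (2 * m) * Gamma x"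
    by (meson mult_right_mono norm_ge_zero order_trans)
  then have "(1 + c) ^ m * norm (Gamma z) \<le> Gamma x"
    using px by simp
  then have "(1 + t\<^sup>2 / (36 * real m)) * norm (Gamma z) \<le> Gamma x"
    using bern by (meson mult_right_mono norm_ge_zero order_trans)
  moreover have "1 + t\<^sup>2 / (36 * real m) > 0" by (simp add: add_pos_nonneg)
  ultimately show ?thesis
    using Gx unfolding norm_chi_char x_def[symmetric] z_def[symmetric]
    by (simp add: field_simps)
qed

lemma one_plus_sum_le_prod:
  fixes f :: "'b \<Rightarrow> real"
  assumes "finite A" "\<And>i. i \<in> A \<Longrightarrow> f i \<ge> 0"
  shows "1 + sum f A \<le> (\<Prod>i\<in>A. 1 + f i)"
  using assms
proof (induction rule: finite_induct)
  case (insert a A)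
  have "1 + sum f (insert a A) \<le> (1 + f a) * (1 + sum f A)"
    using insert by (simp add: algebra_simps sum_nonneg)
  also have "\<dots> \<le> (1 + f a) * (\<Prod>i\<in>A. 1 + f i)"
    using insert by (intro mult_left_mono) auto
  finally show ?case using insert by simp
qed simp

text \<open>
  A product of \<open>n\<close> bounds \<open>1 / (1 + c / k)\<close> is at most \<open>1 / (1 + c H)\<close> with \<open>H\<close> the harmonic sum. The
  factor \<open>k = 1\<close>, which has \<open>m = 0\<close>, does not decay in this way and is bounded by \<open>1\<close>; this accounts for
  \<open>harm n - 1\<close>.
\<close>
lemma norm_prod_chi_char_le:
  assumes n: "n \<ge> 1"
  shows "norm (\<Prod>k\<in>{1..n}. chi_char (k div 2) t) \<le> 1 / (1 + t\<^sup>2 / 36 * (harm n - 1))"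
proof -
  have split: "{1..n} = insert 1 {2..n}" using n by auto
  have h: "harm n - 1 = (\<Sum>k\<in>{2..n}. 1 / real k)"
    unfolding harm_def split by (simp add: inverse_eq_divide)
  have "norm (\<Prod>k\<in>{1..n}. chi_char (k div 2) t) = (\<Prod>k\<in>{1..n}. norm (chi_char (k div 2) t))"
    by (simp add: prod_norm)
  also have "\<dots> = norm (chi_char 0 t) * (\<Prod>k\<in>{2..n}. norm (chi_char (k div 2) t))"
    unfolding split by simp
  also have "\<dots> \<le> 1 * (\<Prod>k\<in>{2..n}. 1 / (1 + t\<^sup>2 / 36 * (1 / real k)))"
  proof (intro mult_mono norm_chi_char_le_1 prod_mono conjI prod_nonneg)
    fix k assume k: "k \<in> {2..n}"
    then have kd: "k div 2 \<ge> 1" "real (k div 2) \<le> real k" by auto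
    have "norm (chi_char (k div 2) t) \<le> 1 / (1 + t\<^sup>2 / (36 * real (k div 2)))"
      by (rule norm_chi_char_le[OF kd(1)])
    also have "\<dots> \<le> 1 / (1 + t\<^sup>2 / 36 * (1 / real k))"
    proof (rule divide_left_mono)
      show "1 + t\<^sup>2 / 36 * (1 / real k) \<le> 1 + t\<^sup>2 / (36 * real (k div 2))"
        using kd by (simp add: divide_left_mono)
      show "0 < (1 + t\<^sup>2 / (36 * real (k div 2))) * (1 + t\<^sup>2 / 36 * (1 / real k))"
        by (intro mult_pos_pos add_pos_nonneg) auto
    qed simp
    finally show "norm (chi_char (k div 2) t) \<le> 1 / (1 + t\<^sup>2 / 36 * (1 / real k))" .
  qed auto
  also have "\<dots> = 1 / (\<Prod>k\<in>{2..n}. 1 + t\<^sup>2 / 36 * (1 / real k))"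
    by (simp add: prod_dividef)
  also have "\<dots> \<le> 1 / (1 + t\<^sup>2 / 36 * (harm n - 1))"
  proof (rule divide_left_mono)
    show "1 + t\<^sup>2 / 36 * (harm n - 1) \<le> (\<Prod>k\<in>{2..n}. 1 + t\<^sup>2 / 36 * (1 / real k))"
      unfolding h sum_distrib_left by (rule one_plus_sum_le_prod) auto
    show "0 < (\<Prod>k\<in>{2..n}. 1 + t\<^sup>2 / 36 * (1 / real k)) * (1 + t\<^sup>2 / 36 * (harm n - 1))"
      unfolding h by (intro mult_pos_pos prod_pos add_pos_nonneg mult_nonneg_nonneg sum_nonneg ballI) auto
  qed simp
  finally show ?thesis .
qed

text \<open>
  Summation by parts with \<open>\<psi> (x + 1) = \<psi> x + 1 / x\<close>. The exact formula matters: replacing each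
  \<open>\<psi> x\<close> by \<open>ln x\<close> would leave an error of order \<open>log n\<close>, which is larger than the standard deviation.
\<close>
lemma sum_Digamma_half_integers:
  "(\<Sum>k\<in>{1..n}. Digamma (real (k div 2) + 1/2)) =
     real n * Digamma (real (n div 2) + 1/2) - 2 * real (n div 2)"
proof (induction n)
  case (Suc n)
  show ?case
  proof (cases "even n")
    case True
    then show ?thesis using Suc by (auto simp: algebra_simps)
  next
    case False
    then obtain N where N: "n = 2 * N + 1" by (rule oddE)
    have "Digamma (real N + 3/2) = Digamma (real N + 1/2) + 1 / (real N + 1/2)"
      using Digamma_plus1[of "real N + 1/2"] by (simp add: add_ac)
    then show ?thesis using Suc unfolding N
      by (simp add: field_simps)
  qed
qed simp

lemma sum_Polygamma1_half_integers:
  "(\<Sum>k\<in>{1..n}. Polygamma 1 (real (k div 2) + 1/2)) =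
     real n * Polygamma 1 (real (n div 2) + 1/2) +
     2 * (Digamma (real (n div 2) + 1/2) - Digamma (1/2))"
proof (induction n)
  case (Suc n)
  show ?case
  proof (cases "even n")
    case True
    then show ?thesis using Suc by (auto simp: algebra_simps)
  next
    case False
    then obtain N where N: "n = 2 * N + 1" by (rule oddE)
    define q where "q = real N + 1/2"
    have q: "q > 0" by (simp add: q_def)
    have "Digamma (q + 1) = Digamma q + 1 / q"
      using Digamma_plus1[of q] q by simp
    moreover have P: "Polygamma 1 (q + 1) = Polygamma 1 q - 1 / q\<^sup>2"
      using Polygamma_plus1[of q 1] q by (simp add: power2_eq_square)
    moreover have "real (Suc n div 2) + 1/2 = q + 1" "real (n div 2) + 1/2 = q" "real n = 2 * q"
      by (simp_all add: N q_def)
    moreover have "q * (1 / q\<^sup>2) = 1 / q" using q by (simp add: power2_eq_square)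
    moreover have "q * Polygamma 1 (q + 1) = q * Polygamma 1 q - q * (1 / q\<^sup>2)"
      unfolding P by (simp only: right_diff_distrib)
    ultimately show ?thesis using Suc
      by (simp add: algebra_simps)
  qed
qed simp

text \<open>
  Monotonicity of \<open>\<psi>\<close> encloses the value at a half-integer between those at the neighbouring integers,
  where it is a harmonic number up to an additive constant.
\<close>
lemma Digamma_half_integer_approx:
  assumes "N \<ge> 1"
  shows "\<bar>Digamma (real N + 1/2) - ln (real N)\<bar> \<le> 2 / real N"
proof -
  have D1: "Digamma (real N + 1) = harm N - euler_mascheroni"
    using Digamma_of_nat[of N, where 'a = real] by (simp add: add_ac)
  have D0: "Digamma (real N + 1) = Digamma (real N) + 1 / real N"
    using assms by (intro Digamma_plus1) auto
  have mono: "Digamma (real N) \<le> Digamma (real N + 1/2)" "Digamma (real N + 1/2) \<le> Digamma (real N + 1)"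
    using assms by (intro Digamma_real_mono; simp)+
  have e: "euler_mascheroni \<ge> harm N - ln (real N + 1) + inverse (2 * (real N + 1))"
      "euler_mascheroni \<le> harm N - ln (real N + 1) + inverse (2 * real N)"
    using euler_mascheroni_bounds[OF assms] by (auto simp: add_ac)
  have "ln (real N + 1) - ln (real N) \<le> 1 / real N"
    using ln_diff_le_inverse[of "real N"] assms by simp
  moreover have "ln (real N) \<le> ln (real N + 1)" using assms by simp
  moreover have "inverse (2 * (real N + 1)) \<ge> 0" by simp
  ultimately have upper: "Digamma (real N + 1) \<le> ln (real N) + 1 / real N"
      and lower: "Digamma (real N) \<ge> ln (real N) - 1 / real N - inverse (2 * real N)"
    using D0 D1 e by linarith+
  have "inverse (2 * real N) \<le> 1 / real N"
    using assms by (simp add: inverse_eq_divide frac_le)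
  with upper lower mono
  have "Digamma (real N + 1/2) \<le> ln (real N) + 1 / real N"
      and "Digamma (real N + 1/2) \<ge> ln (real N) - (1 / real N + 1 / real N)"
    by linarith+
  moreover have "1 / real N + 1 / real N = 2 / real N" "1 / real N \<ge> 0" by simp_all
  ultimately show ?thesis by linarith
qed

text \<open>
  The mean value theorem for \<open>\<psi> (x + 1) - \<psi> x = 1 / x\<close>, together with the fact that \<open>\<psi>'\<close> decreases.
\<close>
lemma Polygamma1_le:
  fixes x :: real
  assumes "x > 0"
  shows "Polygamma 1 (x + 1) \<le> 1 / x"
proof -
  have "\<exists>\<xi>. x < \<xi> \<and> \<xi> < x + 1 \<and> Digamma (x + 1) - Digamma x = (x + 1 - x) * Polygamma (Suc 0) \<xi>"
    using assms by (intro MVT2 derivative_intros impI allI) (auto elim!: nonpos_Ints_cases)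
  then obtain \<xi> where \<xi>: "x < \<xi>" "\<xi> < x + 1" "Digamma (x + 1) - Digamma x = Polygamma 1 \<xi>"
    by auto
  have "Polygamma 1 (x + 1) \<le> Polygamma 1 \<xi>"
    using Polygamma_real_strict_antimono[of \<xi> "x + 1" 1] assms \<xi> by simp
  also have "\<dots> = 1 / x"
    using \<xi>(3) Digamma_plus1[of x] assms by simp
  finally show ?thesis .
qed

section \<open>Gaussian asymptotics of the product of characteristic functions\<close>

definition log_chi_mean :: "nat \<Rightarrow> real" where
  "log_chi_mean m = (ln 2 + Digamma (real m + 1/2)) / 2"

definition log_chi_var :: "nat \<Rightarrow> real" where
  "log_chi_var m = Polygamma 1 (real m + 1/2) / 4"

lemma log_chi_var_pos: "log_chi_var m > 0"
  unfolding log_chi_var_def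
  by (intro divide_pos_pos Polygamma_real_odd_pos) (auto elim!: nonpos_Ints_cases)

lemma chi_char_eq_exp:
  "\<exists>r. chi_char m t = exp (\<i> * of_real (t * log_chi_mean m) - of_real (t\<^sup>2 / 2 * log_chi_var m) + r)
     \<and> norm r \<le> \<bar>t\<bar> ^ 3 * log_chi_var m"
proof -
  define x where "x = real m + 1/2"
  have x: "x > 0" "x \<ge> 1/2" by (simp_all add: x_def)
  define r where "r = ln_Gamma (Complex x (t / 2)) - (ln_Gamma (of_real x) +
      \<i> * of_real (t / 2 * Digamma x) - of_real ((t / 2)\<^sup>2 / 2 * Polygamma 1 x))"
  have exp_ln_Gamma: "Gamma z = exp (ln_Gamma z)" if "Re z > 0" for z
    using that by (auto simp: Gamma_complex_altdef elim!: nonpos_Ints_cases)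
  have "chi_char m t = exp (\<i> * of_real (t / 2 * ln 2) + ln_Gamma (Complex x (t / 2)) - ln_Gamma (of_real x))"
    using x unfolding chi_char_def x_def[symmetric] by (simp add: exp_ln_Gamma exp_add exp_diff)
  also have "\<i> * of_real (t / 2 * ln 2) + ln_Gamma (Complex x (t / 2)) - ln_Gamma (of_real x) =
      \<i> * of_real (t * log_chi_mean m) - of_real (t\<^sup>2 / 2 * log_chi_var m) + r"
    by (simp add: r_def log_chi_mean_def log_chi_var_def x_def power2_eq_square field_simps)
  finally have "chi_char m t =
    exp (\<i> * of_real (t * log_chi_mean m) - of_real (t\<^sup>2 / 2 * log_chi_var m) + r)" .
  moreover have "norm r \<le> \<bar>t\<bar> ^ 3 * log_chi_var m"
  proof -
    have P: "Polygamma 1 x \<ge> 0"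
      using log_chi_var_pos[of m] by (simp add: log_chi_var_def x_def)
    have "norm r \<le> \<bar>t / 2\<bar> ^ 3 / x * Polygamma 1 x"
      unfolding r_def by (rule ln_Gamma_imaginary_Taylor[OF x(1)])
    also have "\<dots> \<le> \<bar>t / 2\<bar> ^ 3 / (1/2) * Polygamma 1 x"
      using x P by (intro mult_right_mono divide_left_mono) auto
    also have "\<dots> = \<bar>t\<bar> ^ 3 * log_chi_var m"
      by (simp add: log_chi_var_def x_def power_divide)
    finally show ?thesis .
  qed
  ultimately show ?thesis by blast
qed

lemma prod_chi_char_eq_exp:
  "\<exists>r. (\<Prod>k\<in>A. chi_char (f k) t) = exp (\<i> * of_real (t * (\<Sum>k\<in>A. log_chi_mean (f k)))
        - of_real (t\<^sup>2 / 2 * (\<Sum>k\<in>A. log_chi_var (f k))) + r)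
     \<and> norm r \<le> \<bar>t\<bar> ^ 3 * (\<Sum>k\<in>A. log_chi_var (f k))"
proof (cases "finite A")
  case True
  obtain r where r: "\<And>m. chi_char m t =
      exp (\<i> * of_real (t * log_chi_mean m) - of_real (t\<^sup>2 / 2 * log_chi_var m) + r m)"
      "\<And>m. norm (r m) \<le> \<bar>t\<bar> ^ 3 * log_chi_var m"
    using chi_char_eq_exp[of _ t] by metis
  show ?thesis
  proof (intro exI conjI)
    show "norm (\<Sum>k\<in>A. r (f k)) \<le> \<bar>t\<bar> ^ 3 * (\<Sum>k\<in>A. log_chi_var (f k))"
      unfolding sum_distrib_left by (rule sum_norm_le) (rule r)
    show "(\<Prod>k\<in>A. chi_char (f k) t) = exp (\<i> * of_real (t * (\<Sum>k\<in>A. log_chi_mean (f k)))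
        - of_real (t\<^sup>2 / 2 * (\<Sum>k\<in>A. log_chi_var (f k))) + (\<Sum>k\<in>A. r (f k)))"
      unfolding r(1) exp_sum[OF True, symmetric]
      by (simp add: sum.distrib sum_subtractf sum_distrib_left)
  qed
qed (auto intro!: exI[of _ 0])

lemma half_bounds:
  assumes "n \<ge> (2::nat)"
  shows "n div 2 \<ge> 1" "real n \<le> 3 * real (n div 2)" "2 * real (n div 2) \<le> real n" "real n \<le> 2 * real (n div 2) + 1"
proof -
  show "n div 2 \<ge> 1" using assms by presburger
  have "n \<le> 3 * (n div 2)" "2 * (n div 2) \<le> n" "n \<le> 2 * (n div 2) + 1"
    using assms by presburger+
  then have "real n \<le> real (3 * (n div 2))" "real (2 * (n div 2)) \<le> real n" "real n \<le> real (2 * (n div 2) + 1)"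
    by (simp_all only: of_nat_le_iff)
  then show "real n \<le> 3 * real (n div 2)" "2 * real (n div 2) \<le> real n" "real n \<le> 2 * real (n div 2) + 1"
    by simp_all
qed

lemma ln_half_bounds:
  assumes n: "n \<ge> (2::nat)"
  shows "ln (real (n div 2)) \<le> ln (real n / 2)" "ln (real n / 2) \<le> ln (real (n div 2)) + 1 / (2 * real (n div 2))"
proof -
  define N where "N = real (n div 2)"
  note h = half_bounds[OF n, folded N_def]
  have N: "N \<ge> 1" using h(1) by (simp add: N_def)
  show "ln N \<le> ln (real n / 2)"
    using h N by (intro ln_mono) auto
  have "ln (real n / 2) \<le> ln (N * (1 + 1 / (2 * N)))"
  proof (rule ln_mono)
    have "N * (1 + 1 / (2 * N)) = N + 1 / 2" using N by (simp add: field_simps)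
    then show "real n / 2 \<le> N * (1 + 1 / (2 * N))" using h by simp
  qed (use n in auto)
  also have "\<dots> = ln N + ln (1 + 1 / (2 * N))"
    using N by (intro ln_mult_pos add_pos_nonneg) auto
  also have "ln (1 + 1 / (2 * N)) \<le> 1 / (2 * N)"
    using N by (intro ln_add_one_self_le_self) auto
  finally show "ln (real n / 2) \<le> ln N + 1 / (2 * N)" by simp
qed

text \<open>
  The approximation of \<open>\<psi>\<close> by \<open>ln\<close> is accurate to order \<open>1 / n\<close>, and the closed form of the sum
  multiplies that error by \<open>n\<close>, so the deviation from \<open>mu_H n\<close> stays bounded.
\<close>
lemma sum_log_chi_mean_approx:
  assumes n: "n \<ge> 2"
  shows "\<bar>(\<Sum>k\<in>{1..n}. log_chi_mean (k div 2)) - mu_H n\<bar> \<le> 6 + \<bar>ln (2 * pi)\<bar>"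
proof -
  define N where "N = real (n div 2)"
  note h = half_bounds[OF n, folded N_def]
  have N: "N \<ge> 1" using h(1) by (simp add: N_def)
  define e where "e = Digamma (N + 1/2) - ln (real n / 2)"
  have "\<bar>Digamma (N + 1/2) - ln N\<bar> \<le> 2 / N"
    using Digamma_half_integer_approx[OF h(1)] by (simp add: N_def)
  moreover have "\<bar>ln (real n / 2) - ln N\<bar> \<le> 1 / (2 * N)"
    using ln_half_bounds[OF n] by (simp add: N_def)
  ultimately have "\<bar>e\<bar> \<le> 2 / N + 1 / (2 * N)"
    unfolding e_def by linarith
  also have "\<dots> \<le> 3 / N" using N by (simp add: field_simps)
  finally have e: "\<bar>e\<bar> \<le> 3 / N" .
  have "real n / 2 * \<bar>e\<bar> \<le> (3 * N / 2) * (3 / N)"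
    using h e N by (intro mult_mono) auto
  also have "\<dots> = 9 / 2" using N by simp
  finally have ne: "\<bar>real n / 2 * e\<bar> \<le> 9 / 2" by (simp add: abs_mult)
  have "(\<Sum>k\<in>{1..n}. log_chi_mean (k div 2)) = (real n * ln 2 + (real n * Digamma (N + 1/2) - 2 * N)) / 2"
    unfolding log_chi_mean_def N_def sum_Digamma_half_integers[symmetric]
    by (simp add: sum.distrib sum_divide_distrib[symmetric])
  moreover have ln2: "ln (real n / 2) = ln (real n) - ln 2"
    using n by (simp add: ln_div)
  ultimately have "(\<Sum>k\<in>{1..n}. log_chi_mean (k div 2)) - mu_H n =
      real n / 2 * e + (real n - 2 * N) / 2 - ln (2 * pi) / 2"
    unfolding mu_H_def e_def ln2 by (simp add: field_simps)
  moreover have "\<bar>(real n - 2 * N) / 2\<bar> \<le> 1 / 2" using h by simp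
  ultimately show ?thesis using ne by linarith
qed

lemma sum_log_chi_var_approx:
  assumes n: "n \<ge> 2"
  shows "\<bar>(\<Sum>k\<in>{1..n}. log_chi_var (k div 2)) - ln (real n / 2) / 2\<bar> \<le> 4 + \<bar>Digamma (1/2)\<bar>"
proof -
  define N where "N = real (n div 2)"
  note h = half_bounds[OF n, folded N_def]
  have N: "N \<ge> 1" using h(1) by (simp add: N_def)
  have "\<bar>Digamma (N + 1/2) - ln N\<bar> \<le> 2 / N"
    using Digamma_half_integer_approx[OF h(1)] by (simp add: N_def)
  moreover have "\<bar>ln (real n / 2) - ln N\<bar> \<le> 1 / (2 * N)"
    using ln_half_bounds[OF n] by (simp add: N_def)
  moreover have "2 / N \<le> 2" "1 / (2 * N) \<le> 1" using N by (simp_all add: field_simps)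
  ultimately have D: "\<bar>Digamma (N + 1/2) - ln (real n / 2)\<bar> \<le> 3" by linarith
  have "Polygamma 1 (N + 1/2) \<le> 1 / (N - 1/2)"
    using Polygamma1_le[of "N - 1/2"] N by (simp add: add_ac)
  also have "\<dots> \<le> 2 / N" using N by (simp add: field_simps)
  finally have P1: "Polygamma 1 (N + 1/2) \<le> 2 / N" .
  have P0: "Polygamma 1 (N + 1/2) \<ge> 0"
    using log_chi_var_pos[of "n div 2"] by (simp add: log_chi_var_def N_def)
  have "real n * Polygamma 1 (N + 1/2) \<le> (3 * N) * (2 / N)"
    using h P1 P0 N by (intro mult_mono) auto
  also have "\<dots> = 6" using N by simp
  finally have P: "real n * Polygamma 1 (N + 1/2) \<le> 6" "real n * Polygamma 1 (N + 1/2) \<ge> 0"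
    using P0 by auto
  have sum: "(\<Sum>k\<in>{1..n}. log_chi_var (k div 2)) =
      (real n * Polygamma 1 (N + 1/2) + 2 * (Digamma (N + 1/2) - Digamma (1/2))) / 4"
    unfolding log_chi_var_def N_def sum_Polygamma1_half_integers[symmetric]
    by (simp add: sum_divide_distrib[symmetric])
  have "\<bar>S - L / 2\<bar> \<le> 4 + \<bar>d\<bar>"
    if "\<bar>D - L\<bar> \<le> 3" "p \<le> 6" "p \<ge> 0" "S = (p + 2 * (D - d)) / 4" for S L D p d :: real
    using that by (auto simp: abs_le_iff)
  from this[OF D P sum] show ?thesis .
qed

lemma sqrt_log_at_top: "filterlim (\<lambda>n. sqrt (1/2 * ln (real n / 2))) at_top sequentially"
  by real_asymp

text \<open>
  In the exponent the drift is bounded by a constant over \<open>s\<close>, the quadratic term tends to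
  \<open>- u\<^sup>2 / 2\<close>, and the cubic remainder is at most \<open>\<bar>u\<bar>\<^sup>3\<close> times the variance over \<open>s\<^sup>3\<close>.
\<close>
lemma normalized_char_tendsto_gaussian:
  fixes u :: real
  defines "s \<equiv> \<lambda>n. sqrt (1/2 * ln (real n / 2))"
  shows "(\<lambda>n. exp (- (\<i> * of_real (u / s n * mu_H n))) * (\<Prod>k\<in>{1..n}. chi_char (k div 2) (u / s n)))
           \<longlonglongrightarrow> of_real (exp (- (u\<^sup>2 / 2)))"
proof -
  define mean where "mean n = (\<Sum>k\<in>{1..n}. log_chi_mean (k div 2))" for n
  define var where "var n = (\<Sum>k\<in>{1..n}. log_chi_var (k div 2))" for n
  have s_top: "filterlim s at_top sequentially"
    unfolding s_def by (rule sqrt_log_at_top)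
  have s_pos: "\<forall>\<^sub>F n in sequentially. s n > 0"
    using s_top by (simp add: filterlim_at_top_dense)
  have inv_s: "(\<lambda>n. inverse (s n)) \<longlonglongrightarrow> 0"
    using s_top by (rule tendsto_inverse_0_at_top)
  have "\<exists>r. (\<Prod>k\<in>{1..n}. chi_char (k div 2) (u / s n)) =
        exp (\<i> * of_real (u / s n * mean n) - of_real ((u / s n)\<^sup>2 / 2 * var n) + r) \<and>
      norm r \<le> \<bar>u / s n\<bar> ^ 3 * var n" for n
    unfolding mean_def var_def by (rule prod_chi_char_eq_exp)
  then obtain r where r: "\<And>n. (\<Prod>k\<in>{1..n}. chi_char (k div 2) (u / s n)) =
        exp (\<i> * of_real (u / s n * mean n) - of_real ((u / s n)\<^sup>2 / 2 * var n) + r n)"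
      "\<And>n. norm (r n) \<le> \<bar>u / s n\<bar> ^ 3 * var n"
    by metis
  have mean_lim: "(\<lambda>n. (mean n - mu_H n) / s n) \<longlonglongrightarrow> 0"
  proof (rule Lim_null_comparison)
    show "(\<lambda>n. (6 + \<bar>ln (2 * pi)\<bar>) * inverse (s n)) \<longlonglongrightarrow> 0"
      using tendsto_mult_right_zero[OF inv_s] .
    show "\<forall>\<^sub>F n in sequentially. norm ((mean n - mu_H n) / s n) \<le> (6 + \<bar>ln (2 * pi)\<bar>) * inverse (s n)"
      using eventually_ge_at_top[of 2] s_pos
    proof eventually_elim
      case (elim n)
      then show ?case using sum_log_chi_mean_approx[of n]
        by (simp add: mean_def divide_inverse abs_mult mult_right_mono)
    qed
  qed
  have "(\<lambda>n. (var n - (s n)\<^sup>2) / (s n)\<^sup>2) \<longlonglongrightarrow> 0"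
  proof (rule Lim_null_comparison)
    show "(\<lambda>n. (4 + \<bar>Digamma (1/2)\<bar>) / (s n)\<^sup>2) \<longlonglongrightarrow> 0"
      by (intro real_tendsto_divide_at_top[OF tendsto_const] filterlim_pow_at_top s_top) simp
    show "\<forall>\<^sub>F n in sequentially. norm ((var n - (s n)\<^sup>2) / (s n)\<^sup>2) \<le> (4 + \<bar>Digamma (1/2)\<bar>) / (s n)\<^sup>2"
      using eventually_ge_at_top[of 2] s_pos
    proof eventually_elim
      case (elim n)
      have "1/2 * ln (real n / 2) \<ge> 0" using elim(1) by simp
      then have "(s n)\<^sup>2 = ln (real n / 2) / 2" by (simp add: s_def)
      then have "\<bar>var n - (s n)\<^sup>2\<bar> \<le> 4 + \<bar>Digamma (1/2)\<bar>"
        using sum_log_chi_var_approx[OF elim(1)] by (simp add: var_def)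
      then show ?case
        unfolding real_norm_def abs_divide abs_power2 by (rule divide_right_mono) simp
    qed
  qed
  from tendsto_add[OF this tendsto_const[of 1]]
  have "(\<lambda>n. (var n - (s n)\<^sup>2) / (s n)\<^sup>2 + 1) \<longlonglongrightarrow> 1" by simp
  moreover have "\<forall>\<^sub>F n in sequentially. (var n - (s n)\<^sup>2) / (s n)\<^sup>2 + 1 = var n / (s n)\<^sup>2"
    using s_pos by eventually_elim (simp add: field_simps)
  ultimately have var_lim: "(\<lambda>n. var n / (s n)\<^sup>2) \<longlonglongrightarrow> 1"
    by (rule Lim_transform_eventually)
  have r_lim: "r \<longlonglongrightarrow> 0"
  proof (rule Lim_null_comparison)
    show "(\<lambda>n. \<bar>u\<bar> ^ 3 * (var n / (s n)\<^sup>2 * inverse (s n))) \<longlonglongrightarrow> 0"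
      by (rule tendsto_eq_rhs[OF tendsto_mult[OF tendsto_const tendsto_mult[OF var_lim inv_s]]]) simp
    show "\<forall>\<^sub>F n in sequentially. norm (r n) \<le> \<bar>u\<bar> ^ 3 * (var n / (s n)\<^sup>2 * inverse (s n))"
      using s_pos
    proof eventually_elim
      case (elim n)
      then have "\<bar>u / s n\<bar> ^ 3 * var n = \<bar>u\<bar> ^ 3 * (var n / (s n)\<^sup>2 * inverse (s n))"
        by (simp add: power2_eq_square power3_eq_cube divide_inverse mult_ac abs_mult)
      with r(2)[of n] show ?case by simp
    qed
  qed
  have "(\<lambda>n. exp (\<i> * of_real (u * ((mean n - mu_H n) / s n)) - of_real (u\<^sup>2 / 2 * (var n / (s n)\<^sup>2)) + r n))
      \<longlonglongrightarrow> exp (\<i> * of_real (u * 0) - of_real (u\<^sup>2 / 2 * 1) + 0)"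
    by (intro tendsto_intros mean_lim var_lim r_lim)
  moreover have "exp (- (\<i> * of_real (u / s n * mu_H n))) * (\<Prod>k\<in>{1..n}. chi_char (k div 2) (u / s n)) =
      exp (\<i> * of_real (u * ((mean n - mu_H n) / s n)) - of_real (u\<^sup>2 / 2 * (var n / (s n)\<^sup>2)) + r n)" for n
    unfolding r(1) exp_add[symmetric]
    by (rule arg_cong[where f = exp]) (simp add: power_divide diff_divide_distrib algebra_simps)
  ultimately show ?thesis
    by (simp add: exp_of_real[symmetric] del: of_real_power)
qed

lemma normalized_char_dominated:
  defines "s \<equiv> \<lambda>n. sqrt (1/2 * ln (real n / 2))"
  shows "\<forall>\<^sub>F n in sequentially. \<forall>u. norm (exp (- (\<i> * of_real (u / s n * mu_H n))) *
           (\<Prod>k\<in>{1..n}. chi_char (k div 2) (u / s n))) \<le> inverse (1 + (u / 6)\<^sup>2)"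
proof -
  have "\<forall>\<^sub>F n::nat in sequentially. ln (real n) - 1 \<ge> 1/2 * ln (real n / 2) \<and> 1/2 * ln (real n / 2) > 0"
    by (intro eventually_conj; real_asymp)
  then show ?thesis
    using eventually_ge_at_top[of 1]
  proof eventually_elim
    case (elim n)
    have s2: "(s n)\<^sup>2 = 1/2 * ln (real n / 2)" and s: "s n > 0" using elim by (auto simp: s_def)
    have "ln (real n) \<le> ln (real n + 1)" using elim by simp
    then have h: "harm n - 1 \<ge> (s n)\<^sup>2"
      using harm_ge_ln[of n] elim unfolding s2 by linarith
    have h0: "harm n - (1 :: real) \<ge> 0"
      using h zero_le_power2[of "s n"] by linarith
    show ?case
    proof
      fix u
      have "norm (exp (- (\<i> * of_real (u / s n * mu_H n))) * (\<Prod>k\<in>{1..n}. chi_char (k div 2) (u / s n))) =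
          norm (\<Prod>k\<in>{1..n}. chi_char (k div 2) (u / s n))"
        by (simp add: norm_mult norm_exp_eq_Re)
      also have "\<dots> \<le> 1 / (1 + (u / s n)\<^sup>2 / 36 * (harm n - 1))"
        using elim by (intro norm_prod_chi_char_le)
      also have "\<dots> \<le> 1 / (1 + (u / s n)\<^sup>2 / 36 * (s n)\<^sup>2)"
        using h h0 by (intro divide_left_mono add_left_mono mult_left_mono mult_pos_pos add_pos_nonneg mult_nonneg_nonneg) auto
      also have "\<dots> = inverse (1 + (u / 6)\<^sup>2)"
        using s by (simp add: power_divide inverse_eq_divide)
      finally show "norm (exp (- (\<i> * of_real (u / s n * mu_H n))) *
          (\<Prod>k\<in>{1..n}. chi_char (k div 2) (u / s n))) \<le> inverse (1 + (u / 6)\<^sup>2)" .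
    qed
  qed
qed

lemma integrable_inverse_one_plus_square_scaled:
  "integrable lborel (\<lambda>u::real. inverse (1 + (u / 6)\<^sup>2))"
proof -
  have "integrable lborel (\<lambda>u::real. inverse (1 + u\<^sup>2))"
    using integrable_inverse_1_plus_square by (simp add: set_integrable_def)
  then show ?thesis
    using lborel_integrable_real_affine[of "\<lambda>u::real. inverse (1 + u\<^sup>2)" "1/6" 0] by simp
qed

section \<open>Hankel determinants and orthogonal polynomials\<close>

text \<open>
  The coefficient of \<open>y\<^sup>j\<close> at \<open>(y - x\<^sub>0) \<dots> (y - x\<^sub>k\<^sub>-\<^sub>1)\<close> in Newton's basis, that is, the complete
  homogeneous symmetric polynomial of degree \<open>j - k\<close> in \<open>x\<^sub>0, \<dots>, x\<^sub>k\<close>.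
\<close>
fun newton_coeff :: "(nat \<Rightarrow> 'a::comm_ring_1) \<Rightarrow> nat \<Rightarrow> nat \<Rightarrow> 'a" where
  "newton_coeff x k 0 = (if k = 0 then 1 else 0)"
| "newton_coeff x k (Suc j) = (case k of 0 \<Rightarrow> 0 | Suc l \<Rightarrow> newton_coeff x l j) + x k * newton_coeff x k j"

lemma newton_coeff_eq_0: "j < k \<Longrightarrow> newton_coeff x k j = 0"
  by (induction j arbitrary: k) (auto split: nat.splits)

lemma newton_coeff_diag: "newton_coeff x j j = 1"
  by (induction j) (auto simp: newton_coeff_eq_0)

lemma power_eq_sum_newton:
  "y ^ j = (\<Sum>k\<le>j. newton_coeff x k j * (\<Prod>l<k. y - x l))"
proof (induction j)
  case (Suc j)
  let ?N = "\<lambda>k. \<Prod>l<k. y - x l"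
  have "(\<Sum>k\<le>Suc j. newton_coeff x k (Suc j) * ?N k) =
      (\<Sum>k\<le>Suc j. (case k of 0 \<Rightarrow> 0 | Suc l \<Rightarrow> newton_coeff x l j) * ?N k) +
      (\<Sum>k\<le>Suc j. x k * newton_coeff x k j * ?N k)"
    by (simp only: newton_coeff.simps ring_distribs sum.distrib)
  also have "(\<Sum>k\<le>Suc j. (case k of 0 \<Rightarrow> 0 | Suc l \<Rightarrow> newton_coeff x l j) * ?N k) =
      (\<Sum>k\<le>j. newton_coeff x k j * ?N (Suc k))"
    by (subst sum.atMost_Suc_shift) simp
  also have "(\<Sum>k\<le>Suc j. x k * newton_coeff x k j * ?N k) = (\<Sum>k\<le>j. x k * newton_coeff x k j * ?N k)"
    by (simp add: newton_coeff_eq_0)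
  also have "(\<Sum>k\<le>j. newton_coeff x k j * ?N (Suc k)) + \<dots> = (\<Sum>k\<le>j. newton_coeff x k j * ?N k) * y"
    unfolding sum.distrib[symmetric] sum_distrib_right
    by (intro sum.cong) (simp_all add: algebra_simps)
  finally show ?case using Suc by (simp add: mult.commute)
qed simp

text \<open>
  Newton's basis factors the matrix: evaluating its elements at the nodes gives a lower triangular
  matrix with the products of differences on the diagonal, and the change of basis is upper
  unitriangular.
\<close>
lemma det_vandermonde:
  fixes x :: "nat \<Rightarrow> 'a::idom"
  shows "Determinant.det (Matrix.mat n n (\<lambda>(i, j). x i ^ j)) = (\<Prod>k<n. \<Prod>j<k. x k - x j)"
proof -
  define L where "L = Matrix.mat n n (\<lambda>(i, k). \<Prod>l<k. x i - x l)"
  define U where "U = Matrix.mat n n (\<lambda>(k, j). newton_coeff x k j)"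
  have LU: "L \<in> carrier_mat n n" "U \<in> carrier_mat n n" by (simp_all add: L_def U_def)
  have "Matrix.mat n n (\<lambda>(i, j). x i ^ j) = L * U"
  proof (rule eq_matI)
    fix i j assume "i < dim_row (L * U)" "j < dim_col (L * U)"
    then have ij: "i < n" "j < n" by (simp_all add: L_def U_def)
    have "x i ^ j = (\<Sum>k\<le>j. newton_coeff x k j * (\<Prod>l<k. x i - x l))"
      by (rule power_eq_sum_newton)
    also have "\<dots> = (\<Sum>k = 0..<n. (\<Prod>l<k. x i - x l) * newton_coeff x k j)"
      using ij by (intro sum.mono_neutral_cong_left) (auto simp: newton_coeff_eq_0)
    finally show "Matrix.mat n n (\<lambda>(i, j). x i ^ j) $$ (i, j) = (L * U) $$ (i, j)"
      using ij by (simp add: L_def U_def scalar_prod_def)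
  qed (simp_all add: L_def U_def)
  moreover have "Determinant.det L = (\<Prod>k<n. \<Prod>j<k. x k - x j)"
    by (subst det_lower_triangular[OF _ LU(1)])
       (auto simp: L_def prod_list_diag_prod lessThan_atLeast0)
  moreover have "Determinant.det U = 1"
    by (subst det_upper_triangular[OF _ LU(2)])
       (auto simp: U_def prod_list_diag_prod upper_triangular_def newton_coeff_diag newton_coeff_eq_0)
  ultimately show ?thesis
    using det_mult[OF LU] by simp
qed

text \<open>
  The coefficient of \<open>x\<^sup>i\<close> in the \<open>k\<close>-th monic polynomial of the three-term recurrence
  \<open>p\<^sub>k\<^sub>+\<^sub>2 = x p\<^sub>k\<^sub>+\<^sub>1 - \<gamma>\<^sub>k\<^sub>+\<^sub>1 p\<^sub>k\<close> with \<open>p\<^sub>0 = 1\<close> and \<open>p\<^sub>1 = x\<close>.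
\<close>
fun op_coeff :: "(nat \<Rightarrow> 'a::comm_ring_1) \<Rightarrow> nat \<Rightarrow> nat \<Rightarrow> 'a" where
  "op_coeff \<gamma> 0 i = (if i = 0 then 1 else 0)"
| "op_coeff \<gamma> (Suc 0) i = (if i = 1 then 1 else 0)"
| "op_coeff \<gamma> (Suc (Suc k)) i =
     (case i of 0 \<Rightarrow> 0 | Suc l \<Rightarrow> op_coeff \<gamma> (Suc k) l) - \<gamma> (Suc k) * op_coeff \<gamma> k i"

lemma op_coeff_eq_0: "k < i \<Longrightarrow> op_coeff \<gamma> k i = 0"
  by (induction \<gamma> k i rule: op_coeff.induct) (auto split: nat.splits)

lemma op_coeff_diag: "op_coeff \<gamma> k k = 1"
  by (induction k rule: induct_nat_012) (auto simp: op_coeff_eq_0)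

text \<open>
  The pairing of \<open>p\<^sub>k\<close> with \<open>x\<^sup>j\<close> under the linear functional that has the moments \<open>M\<close>.
\<close>
definition op_moment :: "(nat \<Rightarrow> 'a::comm_ring_1) \<Rightarrow> (nat \<Rightarrow> 'a) \<Rightarrow> nat \<Rightarrow> nat \<Rightarrow> 'a" where
  "op_moment \<gamma> M k j = (\<Sum>i\<le>k. op_coeff \<gamma> k i * M (i + j))"

lemma op_moment_0: "op_moment \<gamma> M 0 j = M j"
  and op_moment_1: "op_moment \<gamma> M (Suc 0) j = M (Suc j)"
  by (simp_all add: op_moment_def)

text \<open>
  This recurrence determines all pairings from the moments. Orthogonality will follow by solving it in
  closed form.
\<close>
lemma op_moment_Suc_Suc:
  "op_moment \<gamma> M (Suc (Suc k)) j = op_moment \<gamma> M (Suc k) (Suc j) - \<gamma> (Suc k) * op_moment \<gamma> M k j"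
proof -
  have "op_moment \<gamma> M (Suc (Suc k)) j =
      (\<Sum>i\<le>Suc (Suc k). (case i of 0 \<Rightarrow> 0 | Suc l \<Rightarrow> op_coeff \<gamma> (Suc k) l) * M (i + j)) -
      (\<Sum>i\<le>Suc (Suc k). \<gamma> (Suc k) * (op_coeff \<gamma> k i * M (i + j)))"
    unfolding op_moment_def op_coeff.simps sum_subtractf[symmetric]
    by (simp only: ring_distribs mult.assoc)
  also have "(\<Sum>i\<le>Suc (Suc k). (case i of 0 \<Rightarrow> 0 | Suc l \<Rightarrow> op_coeff \<gamma> (Suc k) l) * M (i + j)) =
      op_moment \<gamma> M (Suc k) (Suc j)"
    unfolding op_moment_def by (subst sum.atMost_Suc_shift) simp
  also have "(\<Sum>i\<le>Suc (Suc k). \<gamma> (Suc k) * (op_coeff \<gamma> k i * M (i + j))) = \<gamma> (Suc k) * op_moment \<gamma> M k j"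
    by (simp add: op_moment_def sum_distrib_left op_coeff_eq_0)
  finally show ?thesis .
qed

text \<open>
  Multiplying the Hankel matrix by the unitriangular coefficient matrix of the orthogonal polynomials
  gives the matrix of pairings, which orthogonality makes upper triangular.
\<close>
lemma det_hankel:
  fixes M :: "nat \<Rightarrow> 'a::idom"
  assumes orth: "\<And>k j. j < k \<Longrightarrow> op_moment \<gamma> M k j = 0"
  shows "Determinant.det (Matrix.mat n n (\<lambda>(i, j). M (i + j))) = (\<Prod>k<n. op_moment \<gamma> M k k)"
proof -
  define H where "H = Matrix.mat n n (\<lambda>(i, j). M (i + j))"
  define P where "P = Matrix.mat n n (\<lambda>(k, i). op_coeff \<gamma> k i)"
  define A where "A = Matrix.mat n n (\<lambda>(k, j). op_moment \<gamma> M k j)"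
  have carr: "H \<in> carrier_mat n n" "P \<in> carrier_mat n n" "A \<in> carrier_mat n n"
    by (simp_all add: H_def P_def A_def)
  have "A = P * H"
  proof (rule eq_matI)
    fix k j assume "k < dim_row (P * H)" "j < dim_col (P * H)"
    then have kj: "k < n" "j < n" by (simp_all add: P_def H_def)
    have "op_moment \<gamma> M k j = (\<Sum>i = 0..<n. op_coeff \<gamma> k i * M (i + j))"
      unfolding op_moment_def
      using kj by (intro sum.mono_neutral_cong_left) (auto simp: op_coeff_eq_0)
    then show "A $$ (k, j) = (P * H) $$ (k, j)"
      using kj by (simp add: A_def P_def H_def scalar_prod_def)
  qed (simp_all add: A_def P_def H_def)
  moreover have "Determinant.det P = 1"
    by (subst det_lower_triangular[OF _ carr(2)])
       (auto simp: P_def prod_list_diag_prod op_coeff_diag op_coeff_eq_0)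
  moreover have "Determinant.det A = (\<Prod>k<n. op_moment \<gamma> M k k)"
    by (subst det_upper_triangular[OF _ carr(3)])
       (auto simp: A_def prod_list_diag_prod upper_triangular_def orth lessThan_atLeast0)
  ultimately show ?thesis
    using det_mult[OF carr(2,1)] by (simp add: H_def)
qed

text \<open>
  The recurrence coefficients of the generalized Hermite polynomials, which are orthogonal for the
  weight \<open>\<bar>x\<bar>\<^sup>s exp (- x\<^sup>2 / 2)\<close>. As \<open>s\<close> will be imaginary, orthogonality is meant with respect to a
  bilinear functional; everything here is algebra in \<open>s\<close>.
\<close>
definition hermite_rec :: "'a::comm_ring_1 \<Rightarrow> nat \<Rightarrow> 'a" where
  "hermite_rec s k = (if even k then of_nat k else of_nat k + s)"

text \<open>
  The two hypotheses express that the weight is even and how integration by parts against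
  \<open>exp (- x\<^sup>2 / 2)\<close> lowers the degree. The four cases form one induction because each recurrence step changes
  the parity of the degree. The product over \<open>r\<close> vanishes for \<open>j < m\<close>; this is the orthogonality.
\<close>
lemma hermite_op_moment:
  fixes M :: "nat \<Rightarrow> 'a::comm_ring_1"
  assumes odd: "\<And>j. M (2 * j + 1) = 0"
    and rec: "\<And>j. M (2 * j + 2) = (of_nat (2 * j + 1) + s) * M (2 * j)"
  shows "op_moment (hermite_rec s) M (2 * m) (2 * j) = M (2 * j) * (\<Prod>r<m. of_nat (2 * j) - of_nat (2 * r)) \<and>
    op_moment (hermite_rec s) M (2 * m) (2 * j + 1) = 0 \<and>
    op_moment (hermite_rec s) M (2 * m + 1) (2 * j + 1) = M (2 * j + 2) * (\<Prod>r<m. of_nat (2 * j) - of_nat (2 * r)) \<and>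
    op_moment (hermite_rec s) M (2 * m + 1) (2 * j) = 0"
proof (induction m arbitrary: j)
  case 0
  show ?case using odd by (simp add: op_moment_0 op_moment_1)
next
  case (Suc m)
  let ?a = "op_moment (hermite_rec s) M"
  let ?F = "\<lambda>m j. \<Prod>r<m. of_nat (2 * j) - of_nat (2 * r) :: 'a"
  have shift: "?F (Suc m) (Suc j) = of_nat (2 * j + 2) * ?F m j" for j
    by (subst prod.lessThan_Suc_shift) (simp add: algebra_simps)
  have e1: "?a (2 * Suc m) (2 * j) = M (2 * j) * ?F (Suc m) j" for j
  proof -
    have "?a (2 * Suc m) (2 * j) =
        ?a (2 * m + 1) (2 * j + 1) - (of_nat (2 * m + 1) + s) * ?a (2 * m) (2 * j)"
      using op_moment_Suc_Suc[of "hermite_rec s" M "2 * m" "2 * j"]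
      by (simp add: hermite_rec_def[of _ "Suc (2 * m)"])
    also have "\<dots> = M (2 * j) * (?F m j * (of_nat (2 * j) - of_nat (2 * m)))"
      using Suc[of j] rec[of j] by (simp add: algebra_simps)
    finally show ?thesis by simp
  qed
  have e2: "?a (2 * Suc m) (2 * j + 1) = 0" for j
    using op_moment_Suc_Suc[of "hermite_rec s" M "2 * m" "2 * j + 1"] Suc[of j] Suc[of "Suc j"]
    by simp
  have e3: "?a (2 * Suc m + 1) (2 * j + 1) = M (2 * j + 2) * ?F (Suc m) j" for j
  proof -
    have "?a (2 * Suc m + 1) (2 * j + 1) =
        ?a (2 * Suc m) (2 * Suc j) - of_nat (2 * Suc m) * ?a (2 * m + 1) (2 * j + 1)"
      using op_moment_Suc_Suc[of "hermite_rec s" M "2 * m + 1" "2 * j + 1"]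
      by (simp add: hermite_rec_def[of _ "Suc (Suc (2 * m))"])
    also have "\<dots> = M (2 * j + 2) * (?F (Suc m) (Suc j) - of_nat (2 * Suc m) * ?F m j)"
      using e1[of "Suc j"] Suc[of j] by (simp add: algebra_simps)
    also have "?F (Suc m) (Suc j) - of_nat (2 * Suc m) * ?F m j = ?F (Suc m) j"
      unfolding shift by (simp add: algebra_simps)
    finally show ?thesis .
  qed
  have e4: "?a (2 * Suc m + 1) (2 * j) = 0" for j
    using op_moment_Suc_Suc[of "hermite_rec s" M "2 * m + 1" "2 * j"] Suc[of j] e2[of j]
    by simp
  show ?case using e1 e2 e3 e4 by blast
qed

text \<open>
  The second factor is the same for all \<open>s\<close> and will cancel in the quotient of two such determinants;
  the dependence on the weight is confined to one even moment for each \<open>k\<close>.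
\<close>
lemma det_hankel_hermite:
  fixes M :: "nat \<Rightarrow> 'a::idom"
  assumes odd: "\<And>j. M (2 * j + 1) = 0"
    and rec: "\<And>j. M (2 * j + 2) = (of_nat (2 * j + 1) + s) * M (2 * j)"
  shows "Determinant.det (Matrix.mat n n (\<lambda>(i, j). M (i + j))) =
     (\<Prod>k<n. M (2 * (Suc k div 2)) * (\<Prod>r<k div 2. of_nat (2 * (k div 2)) - of_nat (2 * r)))"
proof -
  note H = hermite_op_moment[OF odd rec]
  have zero: "(\<Prod>r<m. of_nat (2 * j) - of_nat (2 * r) :: 'a) = 0" if "j < m" for m j
    using that by (intro prod_zero) auto
  have "op_moment (hermite_rec s) M k j = 0" if "j < k" for k j
  proof (cases "even k"; cases "even j")
    assume "even k" "even j"
    then obtain m i where "k = 2 * m" "j = 2 * i" by (auto elim!: evenE)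
    then show ?thesis using H[of m i] zero[of i m] that by simp
  next
    assume "even k" "odd j"
    then obtain m i where "k = 2 * m" "j = 2 * i + 1" by (auto elim!: evenE oddE)
    then show ?thesis using H[of m i] by simp
  next
    assume "odd k" "even j"
    then obtain m i where "k = 2 * m + 1" "j = 2 * i" by (auto elim!: evenE oddE)
    then show ?thesis using H[of m i] by simp
  next
    assume "odd k" "odd j"
    then obtain m i where "k = 2 * m + 1" "j = 2 * i + 1" by (auto elim!: oddE)
    then show ?thesis using H[of m i] zero[of i m] that by simp
  qed
  then have "Determinant.det (Matrix.mat n n (\<lambda>(i, j). M (i + j))) = (\<Prod>k<n. op_moment (hermite_rec s) M k k)"
    by (rule det_hankel)
  also have "\<dots> = (\<Prod>k<n. M (2 * (Suc k div 2)) * (\<Prod>r<k div 2. of_nat (2 * (k div 2)) - of_nat (2 * r)))"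
  proof (rule prod.cong)
    fix k
    show "op_moment (hermite_rec s) M k k =
        M (2 * (Suc k div 2)) * (\<Prod>r<k div 2. of_nat (2 * (k div 2)) - of_nat (2 * r))"
    proof (cases "even k")
      case True
      then obtain m where "k = 2 * m" by (auto elim!: evenE)
      then show ?thesis using H[of m m] by simp
    next
      case False
      then obtain m where "k = 2 * m + 1" by (auto elim!: oddE)
      then show ?thesis using H[of m m] by simp
    qed
  qed simp
  finally show ?thesis .
qed

text \<open>
  Expanding both Vandermonde determinants over permutations \<open>p\<close> and \<open>q\<close> makes the integrand a sum of
  products of functions of single variables. For fixed \<open>p\<close> the sum over \<open>q\<close> is the Hankel determinant
  with rows permuted by \<open>p\<close>, so the signs cancel and all \<open>n!\<close> choices of \<open>p\<close> contribute equally.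
\<close>
lemma heine_identity:
  fixes w :: "real \<Rightarrow> complex"
  assumes int: "\<And>j. integrable lborel (\<lambda>x. of_real x ^ j * w x)"
  defines "M \<equiv> \<lambda>j. \<integral>x. of_real x ^ j * w x \<partial>lborel"
  shows "has_bochner_integral (Pi\<^sub>M {..<n} (\<lambda>_. lborel))
     (\<lambda>x. (\<Prod>k<n. \<Prod>j<k. complex_of_real (x k) - of_real (x j))\<^sup>2 * (\<Prod>k<n. w (x k)))
     (fact n * Determinant.det (Matrix.mat n n (\<lambda>(i, j). M (i + j))))"
proof -
  interpret product_sigma_finite "\<lambda>_::nat. lborel :: real measure" ..
  define H where "H = Matrix.mat n n (\<lambda>(i, j). M (i + j))"
  have H: "H \<in> carrier_mat n n" by (simp add: H_def)
  define S where "S = {p. p permutes {0..<n}}"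
  have fin: "finite S" unfolding S_def by (rule finite_permutations) simp
  define T where "T p q x = (\<Prod>i\<in>{..<n}. complex_of_real (x i) ^ (p i + q i) * w (x i))"
    for p q :: "nat \<Rightarrow> nat" and x
  have vdm: "(\<Prod>k<n. \<Prod>j<k. complex_of_real (x k) - of_real (x j)) =
      (\<Sum>p\<in>S. signof p * (\<Prod>i\<in>{..<n}. of_real (x i) ^ p i))" for x
  proof -
    have "(\<Prod>k<n. \<Prod>j<k. complex_of_real (x k) - of_real (x j)) =
        Determinant.det (Matrix.mat n n (\<lambda>(i, j). complex_of_real (x i) ^ j))"
      by (rule det_vandermonde[symmetric])
    also have "\<dots> = (\<Sum>p\<in>S. signof p * (\<Prod>i\<in>{..<n}. of_real (x i) ^ p i))"
      unfolding S_def lessThan_atLeast0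
      by (subst det_def'[of _ n]) (auto intro!: sum.cong prod.cong)
    finally show ?thesis .
  qed
  have expand: "(\<Prod>k<n. \<Prod>j<k. complex_of_real (x k) - of_real (x j))\<^sup>2 * (\<Prod>k<n. w (x k)) =
      (\<Sum>p\<in>S. \<Sum>q\<in>S. signof p * signof q * T p q x)" for x
    unfolding vdm power2_eq_square unfolding sum_product unfolding sum_distrib_right
    by (intro sum.cong refl) (simp add: T_def prod.distrib power_add mult_ac)
  have T: "has_bochner_integral (Pi\<^sub>M {..<n} (\<lambda>_. lborel)) (T p q) (\<Prod>i<n. M (p i + q i))" for p q
    unfolding has_bochner_integral_iff T_def M_def
    by (intro conjI product_integrable_prod product_integral_prod int) auto
  have "has_bochner_integral (Pi\<^sub>M {..<n} (\<lambda>_. lborel))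
     (\<lambda>x. \<Sum>p\<in>S. \<Sum>q\<in>S. signof p * signof q * T p q x)
     (\<Sum>p\<in>S. \<Sum>q\<in>S. signof p * signof q * (\<Prod>i<n. M (p i + q i)))"
    by (intro has_bochner_integral_sum has_bochner_integral_mult_right T)
  moreover have "(\<Sum>q\<in>S. signof p * signof q * (\<Prod>i<n. M (p i + q i))) = Determinant.det H" if p: "p \<in> S" for p
  proof -
    have perm: "p i < n" if "i < n" for i
      using p that permutes_in_image[of p "{0..<n}" i] by (simp add: S_def)
    have "Determinant.det (Matrix.mat n n (\<lambda>(i, j). H $$ (p i, j))) =
        (\<Sum>q\<in>S. signof q * (\<Prod>i = 0..<n. Matrix.mat n n (\<lambda>(i, j). H $$ (p i, j)) $$ (i, q i)))"
      unfolding S_def by (subst det_def'[of _ n]) auto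
    also have "\<dots> = (\<Sum>q\<in>S. signof q * (\<Prod>i<n. M (p i + q i)))"
      unfolding lessThan_atLeast0
    proof (intro sum.cong refl arg_cong2[where f = "(*)"] prod.cong)
      fix q i assume "q \<in> S" "i \<in> {0..<n}"
      then have "i < n" "q i < n"
        using permutes_in_image[of q "{0..<n}" i] by (simp_all add: S_def)
      then show "Matrix.mat n n (\<lambda>(i, j). H $$ (p i, j)) $$ (i, q i) = M (p i + q i)"
        using perm by (simp add: H_def)
    qed
    finally have "(\<Sum>q\<in>S. signof q * (\<Prod>i<n. M (p i + q i))) = signof p * Determinant.det H"
      using det_permute_rows[OF H, of p] p by (simp add: S_def)
    then have "(\<Sum>q\<in>S. signof p * signof q * (\<Prod>i<n. M (p i + q i))) = signof p * (signof p * Determinant.det H)"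
      by (simp add: sum_distrib_left mult.assoc flip: sum_distrib_left)
    also have "\<dots> = Determinant.det H"
      by (cases p rule: sign_cases) simp_all
    finally show ?thesis .
  qed
  moreover have "card S = fact n"
    unfolding S_def by (rule card_permutations) auto
  ultimately show ?thesis
    by (simp add: expand H_def)
qed

section \<open>The Mellin transform of the GUE determinant\<close>

definition mellin_weight :: "real \<Rightarrow> real \<Rightarrow> complex" where
  "mellin_weight t x = iexp (t * ln \<bar>x\<bar>) * of_real (exp (- (x\<^sup>2 / 2)))"

lemma mellin_weight_measurable [measurable]: "mellin_weight t \<in> borel_measurable borel"
  unfolding mellin_weight_def by measurable

lemma integrable_mellin_weight: "integrable lborel (\<lambda>x. of_real x ^ j * mellin_weight t x)"
proof (rule Bochner_Integration.integrable_bound)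
  show "integrable lborel (\<lambda>x. sqrt (2 * pi) * (std_normal_density x * x ^ j))"
    by (intro integrable_mult_right integrable_std_normal_moment)
  show "AE x in lborel. norm (of_real x ^ j * mellin_weight t x) \<le> norm (sqrt (2 * pi) * (std_normal_density x * x ^ j))"
    by (intro AE_I2) (simp add: mellin_weight_def std_normal_density_def norm_mult norm_power power_abs abs_mult)
qed measurable

definition mellin_moment :: "real \<Rightarrow> nat \<Rightarrow> complex" where
  "mellin_moment t j = (\<integral>x. of_real x ^ j * mellin_weight t x \<partial>lborel)"

lemma mellin_moment_odd: "mellin_moment t (2 * j + 1) = 0"
proof -
  have "mellin_moment t (2 * j + 1) = (\<integral>x. of_real (0 + (- 1) * x) ^ (2 * j + 1) * mellin_weight t (0 + (- 1) * x) \<partial>lborel)"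
    unfolding mellin_moment_def by (subst lborel_integral_real_affine[where c = "-1" and t = 0]) simp_all
  also have "\<dots> = - mellin_moment t (2 * j + 1)"
    by (simp add: mellin_moment_def mellin_weight_def)
  finally show ?thesis by simp
qed

text \<open>
  The substitution \<open>u = x\<^sup>2 / 2\<close> turns each half line into Euler's integral.
\<close>
lemma mellin_moment_even:
  "mellin_moment t (2 * m) = 2 * exp (of_real ((real m - 1/2) * ln 2) + \<i> * of_real (t / 2 * ln 2)) *
     Gamma (Complex (real m + 1/2) (t / 2))"
proof -
  define z where "z = Complex (real m + 1/2) (t / 2)"
  \<comment> \<open>The factor that takes the substituted integrand to \<open>f\<close>; it is \<open>2\<close> to the power
    \<open>z - 1 = m - 1/2 + i t / 2\<close>.\<close>
  define K where "K = exp (of_real ((real m - 1/2) * ln 2) + \<i> * of_real (t / 2 * ln 2))"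
  define f where "f x = of_real x ^ (2 * m) * mellin_weight t x" for x
  have f_int: "integrable lborel f"
    unfolding f_def by (rule integrable_mellin_weight)
  then have [measurable]: "f \<in> borel_measurable lborel" by auto
  have f_even: "f (- x) = f x" for x
    by (simp add: f_def mellin_weight_def)
  have image: "(\<lambda>x::real. x\<^sup>2 / 2) ` {0<..} = {0<..}"
  proof (intro equalityI subsetI)
    fix u :: real assume "u \<in> {0<..}"
    then have "u = (sqrt (2 * u))\<^sup>2 / 2" "sqrt (2 * u) \<in> {0<..}" by auto
    then show "u \<in> (\<lambda>x. x\<^sup>2 / 2) ` {0<..}" by blast
  qed auto
  have subst: "\<bar>x\<bar> *\<^sub>R (of_real (x\<^sup>2 / 2) powr (z - 1) / of_real (exp (x\<^sup>2 / 2))) = inverse K * f x"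
    if x: "x \<in> {0<..}" for x :: real
  proof -
    \<comment> \<open>Writing every factor as an exponential reduces the claim to a linear identity in the exponents.\<close>
    define L where "L = ln x"
    have xL: "x = exp L" using x by (simp add: L_def)
    have ln: "ln (x\<^sup>2 / 2) = 2 * L - ln 2"
      using x by (simp add: ln_div ln_realpow L_def)
    have "of_real (x\<^sup>2 / 2) powr (z - 1) = exp ((z - 1) * of_real (2 * L - ln 2))"
      using x unfolding ln[symmetric] by (simp add: powr_def Ln_of_real[symmetric])
    then have "\<bar>x\<bar> *\<^sub>R (of_real (x\<^sup>2 / 2) powr (z - 1) / of_real (exp (x\<^sup>2 / 2))) =
        exp (of_real L + (z - 1) * of_real (2 * L - ln 2) - of_real (x\<^sup>2 / 2))"
      using x by (simp add: exp_add exp_diff scaleR_conv_of_real exp_of_real xL[symmetric] del: of_real_power of_real_divide)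
    also have "of_real L + (z - 1) * of_real (2 * L - ln 2) =
        of_nat (2 * m) * of_real L + \<i> * of_real (t * L)
        - (of_real ((real m - 1/2) * ln 2) + \<i> * of_real (t / 2 * ln 2))"
      by (simp add: z_def complex_eq_iff algebra_simps)
    also have "exp (of_nat (2 * m) * of_real L + \<i> * of_real (t * L)
        - (of_real ((real m - 1/2) * ln 2) + \<i> * of_real (t / 2 * ln 2)) - of_real (x\<^sup>2 / 2)) =
        inverse K * (exp (of_nat (2 * m) * of_real L) * iexp (t * L) * exp (- of_real (x\<^sup>2 / 2)))"
      unfolding K_def by (simp only: exp_add exp_diff exp_minus divide_inverse mult_ac)
    also have "exp (of_nat (2 * m) * of_real L) = complex_of_real x ^ (2 * m)"
      unfolding exp_of_nat_mult xL exp_of_real[symmetric] by simp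
    also have "exp (- complex_of_real (x\<^sup>2 / 2)) = of_real (exp (- (x\<^sup>2 / 2)))"
      by (simp only: of_real_minus[symmetric] exp_of_real)
    finally show ?thesis
      using x by (simp add: f_def mellin_weight_def L_def mult_ac)
  qed
  have "Re z > 0" by (simp add: z_def)
  from absolutely_integrable_Gamma_integral'[OF this] Gamma_integral_complex'[OF this]
  have "(\<lambda>u. complex_of_real u powr (z - 1) / of_real (exp u)) absolutely_integrable_on (\<lambda>x::real. x\<^sup>2 / 2) ` {0<..} \<and>
      integral ((\<lambda>x::real. x\<^sup>2 / 2) ` {0<..}) (\<lambda>u. complex_of_real u powr (z - 1) / of_real (exp u)) = Gamma z"
    unfolding image by (auto simp: integral_unique)
  also have "?this \<longleftrightarrow> (\<lambda>x. \<bar>x\<bar> *\<^sub>R (of_real (x\<^sup>2 / 2) powr (z - 1) / of_real (exp (x\<^sup>2 / 2)))) absolutely_integrable_on {0<..} \<and>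
      integral {0<..} (\<lambda>x::real. \<bar>x\<bar> *\<^sub>R (of_real (x\<^sup>2 / 2) powr (z - 1) / of_real (exp (x\<^sup>2 / 2)))) = Gamma z"
    by (rule has_absolute_integral_change_of_variables_real[symmetric])
       (auto intro!: derivative_eq_intros inj_onI simp: power2_eq_iff)
  finally have "integral {0<..} (\<lambda>x::real. \<bar>x\<bar> *\<^sub>R (of_real (x\<^sup>2 / 2) powr (z - 1) / of_real (exp (x\<^sup>2 / 2)))) = Gamma z"
    by blast
  then have "integral {0<..} (\<lambda>x. inverse K * f x) = Gamma z"
    using subst by (metis (no_types, lifting) integral_cong)
  then have "inverse K * integral {0<..} f = Gamma z"
    by simp
  then have half: "integral {0<..} f = K * Gamma z"
    by (simp add: K_def field_simps)
  have "integral {0<..} f = (\<integral>x. indicator {0<..} x *\<^sub>R f x \<partial>lborel)"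
    using set_borel_integral_eq_integral(2)[of "{0<..}" f] f_int
    by (simp add: set_integrable_def set_lebesgue_integral_def integrable_mult_indicator)
  note pos = this[unfolded half, symmetric]
  have "(\<integral>x. indicator {..<0} x *\<^sub>R f x \<partial>lborel) = (\<integral>x. indicator {0<..} x *\<^sub>R f x \<partial>lborel)"
    by (subst lborel_integral_real_affine[where c = "-1" and t = 0])
       (auto simp: f_even indicator_def intro!: Bochner_Integration.integral_cong)
  note neg = this[unfolded pos]
  have "(\<integral>x. f x \<partial>lborel) = (\<integral>x. indicator {..<0} x *\<^sub>R f x + indicator {0<..} x *\<^sub>R f x \<partial>lborel)"
  proof (rule integral_cong_AE)
    show "AE x in lborel. f x = indicator {..<0} x *\<^sub>R f x + indicator {0<..} x *\<^sub>R f x"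
      using AE_lborel_singleton[of 0] by eventually_elim (auto simp: indicator_def)
  qed measurable
  also have "\<dots> = 2 * K * Gamma z"
    using f_int by (subst Bochner_Integration.integral_add) (auto simp: integrable_mult_indicator neg pos)
  finally show ?thesis
    by (simp add: mellin_moment_def f_def z_def K_def)
qed

lemma mellin_moment_rec:
  "mellin_moment t (2 * j + 2) = (of_nat (2 * j + 1) + \<i> * of_real t) * mellin_moment t (2 * j)"
proof -
  define z where "z = Complex (real j + 1/2) (t / 2)"
  define E where "E = exp (of_real ((real j - 1/2) * ln 2) + \<i> * of_real (t / 2 * ln 2))"
  have "z \<notin> \<int>\<^sub>\<le>\<^sub>0" by (auto simp: z_def complex_eq_iff elim!: nonpos_Ints_cases)
  then have "Gamma (z + 1) = z * Gamma z" by (rule Gamma_plus1)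
  moreover have "z + 1 = Complex (real (Suc j) + 1/2) (t / 2)"
    by (simp add: z_def complex_eq_iff)
  ultimately have G: "Gamma (Complex (real (Suc j) + 1/2) (t / 2)) = z * Gamma z" by simp
  have "complex_of_real ((real (Suc j) - 1/2) * ln 2) + \<i> * of_real (t / 2 * ln 2) =
      of_real (ln 2) + (of_real ((real j - 1/2) * ln 2) + \<i> * of_real (t / 2 * ln 2))"
    by (simp add: algebra_simps)
  then have e: "exp (complex_of_real ((real (Suc j) - 1/2) * ln 2) + \<i> * of_real (t / 2 * ln 2)) = 2 * E"
    unfolding E_def by (simp only: exp_add exp_of_real) simp
  have "mellin_moment t (2 * j + 2) = 2 * (2 * E) * (z * Gamma z)"
    using mellin_moment_even[of t "Suc j"] unfolding e G by simp
  also have "\<dots> = (2 * z) * (2 * E * Gamma z)" by simp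
  also have "2 * z = of_nat (2 * j + 1) + \<i> * of_real t"
    by (simp add: z_def complex_eq_iff)
  finally show ?thesis
    by (simp add: mellin_moment_even z_def E_def)
qed

lemma mellin_moment_ratio: "mellin_moment t (2 * m) = chi_char m t * mellin_moment 0 (2 * m)"
proof -
  have "Gamma (complex_of_real (real m + 1/2)) \<noteq> 0"
    using Gamma_real_pos[of "real m + 1/2"] unfolding Gamma_complex_of_real of_real_eq_0_iff by linarith
  moreover have "Complex (real m + 1/2) (0 / 2) = of_real (real m + 1/2)"
    by (simp add: complex_eq_iff)
  ultimately show ?thesis
    unfolding mellin_moment_even chi_char_def by (simp add: exp_add)
qed

text \<open>
  Both determinants at \<open>t\<close> and at \<open>0\<close> are products over \<open>k < n\<close>, and their quotient is a product of
  quotients of even moments, each of which is a value of \<open>chi_char\<close>. The index \<open>Suc k div 2\<close> for \<open>k < n\<close>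
  becomes \<open>k div 2\<close> for \<open>1 \<le> k \<le> n\<close>.
\<close>
lemma has_integral_eigen_weight_mellin:
  fixes n :: nat and t :: real
  defines "Z \<equiv> \<lambda>t. fact n * Determinant.det (Matrix.mat n n (\<lambda>(i, j). mellin_moment t (i + j)))"
  shows "has_bochner_integral (Pi\<^sub>M {..<n} (\<lambda>_. lborel))
      (\<lambda>x. of_real (gue_eigen_weight n x) * (\<Prod>k<n. iexp (t * ln \<bar>x k\<bar>))) (Z t)"
    and "Z t = (\<Prod>k\<in>{1..n}. chi_char (k div 2) t) * Z 0"
proof -
  have "complex_of_real (gue_eigen_weight n x) * (\<Prod>k<n. iexp (t * ln \<bar>x k\<bar>)) =
      (\<Prod>k<n. \<Prod>j<k. complex_of_real (x k) - of_real (x j))\<^sup>2 * (\<Prod>k<n. mellin_weight t (x k))" for x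
    by (simp add: gue_eigen_weight_def mellin_weight_def prod.distrib prod_power_distrib mult_ac)
  then show "has_bochner_integral (Pi\<^sub>M {..<n} (\<lambda>_. lborel))
      (\<lambda>x. of_real (gue_eigen_weight n x) * (\<Prod>k<n. iexp (t * ln \<bar>x k\<bar>))) (Z t)"
    using heine_identity[of "mellin_weight t" n, OF integrable_mellin_weight]
    unfolding Z_def mellin_moment_def by simp
  define c where "c k = (\<Prod>r<k div 2. of_nat (2 * (k div 2)) - of_nat (2 * r) :: complex)" for k
  have Z: "Z t = fact n * (\<Prod>k<n. mellin_moment t (2 * (Suc k div 2)) * c k)" for t
    unfolding Z_def c_def
    by (subst det_hankel_hermite[OF mellin_moment_odd mellin_moment_rec]) simp
  have "Z t = (\<Prod>k<n. chi_char (Suc k div 2) t) * Z 0"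
    unfolding Z mellin_moment_ratio[of t] by (simp add: prod.distrib mult_ac)
  also have "(\<Prod>k<n. chi_char (Suc k div 2) t) = (\<Prod>k\<in>{1..n}. chi_char (k div 2) t)"
    by (rule prod.reindex_bij_witness[of _ "\<lambda>k. k - 1" Suc]) auto
  finally show "Z t = (\<Prod>k\<in>{1..n}. chi_char (k div 2) t) * Z 0" .
qed

text \<open>
  Up to a sign, the determinant is the value at \<open>0\<close> of the characteristic polynomial.
\<close>
lemma cmod_det_eq_prod_eigenvalues:
  fixes A :: "complex mat"
  assumes A: "A \<in> carrier_mat n n"
    and cp: "char_poly A = (\<Prod>k<n. [:- complex_of_real (e k), 1:])"
  shows "cmod (Determinant.det A) = (\<Prod>k<n. \<bar>e k\<bar>)"
proof -
  have "- char_matrix A 0 = (- 1) \<cdot>\<^sub>m A"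
    using A by (intro eq_matI) (auto simp: char_matrix_def)
  then have "poly (char_poly A) 0 = Determinant.det ((- 1) \<cdot>\<^sub>m A)"
    by (simp add: char_poly_matrix[OF A])
  also have "\<dots> = (- 1) ^ n * Determinant.det A" using A by simp
  finally have "cmod (Determinant.det A) = cmod (poly (char_poly A) 0)"
    by (simp add: norm_mult norm_power)
  also have "\<dots> = (\<Prod>k<n. \<bar>e k\<bar>)"
    by (simp add: cp poly_prod prod_norm[symmetric])
  finally show ?thesis .
qed

text \<open>
  The identity \<open>ln (\<Prod>\<^sub>k \<bar>x\<^sub>k\<bar>) = \<Sum>\<^sub>k ln \<bar>x\<^sub>k\<bar>\<close> can fail under the convention \<open>ln 0 = 0\<close> when
  a coordinate vanishes; such points are negligible.
\<close>
lemma AE_PiM_lborel_nonzero: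
  fixes k n :: nat
  assumes "k < n"
  shows "AE x in Pi\<^sub>M {..<n} (\<lambda>_. lborel :: real measure). x k \<noteq> 0"
proof (rule AE_I)
  interpret product_sigma_finite "\<lambda>_::nat. lborel :: real measure" ..
  let ?E = "\<Pi>\<^sub>E i\<in>{..<n}. (if i = k then {0} else UNIV :: real set)"
  show "{x \<in> space (Pi\<^sub>M {..<n} (\<lambda>_. lborel)). \<not> x k \<noteq> (0::real)} \<subseteq> ?E"
    by (auto simp: space_PiM PiE_iff extensional_def)
  have "emeasure (Pi\<^sub>M {..<n} (\<lambda>_. lborel)) ?E = (\<Prod>i\<in>{..<n}. emeasure lborel (if i = k then {0} else UNIV :: real set))"
    using emeasure_PiM[of "{..<n}" "\<lambda>i. if i = k then {0} else UNIV"] by simp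
  also have "\<dots> = 0" using assms by (intro prod_zero) auto
  finally show "emeasure (Pi\<^sub>M {..<n} (\<lambda>_. lborel)) ?E = 0" .
  show "?E \<in> sets (Pi\<^sub>M {..<n} (\<lambda>_. lborel :: real measure))"
    by (rule sets_PiM_I_finite) auto
qed

text \<open>
  The law is an image of the eigenvalue density, so its characteristic function is the Mellin integral
  up to the phase coming from \<open>mu_H n\<close>. The unknown normalizing constant of the eigenvalue density is
  eliminated by the value \<open>1\<close> of the characteristic function at \<open>0\<close>.
\<close>
lemma normalized_gue_law:
  assumes gue: "normalized_gue n M W"
  defines "X \<equiv> \<lambda>\<omega>. X_H n (W \<omega>)"
  shows "X \<in> borel_measurable M" "real_distribution (distr M borel X)"
    "char (distr M borel X) t = exp (- (\<i> * of_real (t * mu_H n))) * (\<Prod>k\<in>{1..n}. chi_char (k div 2) t)"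
proof -
  let ?P = "Pi\<^sub>M {..<n} (\<lambda>_. lborel :: real measure)"
  obtain \<sigma> C where gue_\<sigma>: "gue \<sigma> n M W" and C: "C > 0"
    and joint: "eigenvalues_joint_density n M W (\<lambda>x. C * gue_eigen_weight n x)"
    using gue unfolding normalized_gue_def by auto
  interpret prob_space M using gue_\<sigma> by (simp add: gue_def)
  have carr: "W \<omega> \<in> carrier_mat n n" if "\<omega> \<in> space M" for \<omega>
    using gue_\<sigma> that by (simp add: gue_def)
  obtain \<Lambda> where cp: "\<And>\<omega>. \<omega> \<in> space M \<Longrightarrow> char_poly (W \<omega>) = (\<Prod>k<n. [:- complex_of_real (\<Lambda> \<omega> k), 1:])"
    and dist: "distributed M ?P \<Lambda> (\<lambda>x. ennreal (C * gue_eigen_weight n x))"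
    using joint unfolding eigenvalues_joint_density_def by auto
  have \<Lambda>[measurable]: "\<Lambda> \<in> measurable M ?P"
    and law: "distr M ?P \<Lambda> = density ?P (\<lambda>x. ennreal (C * gue_eigen_weight n x))"
    using dist by (auto simp: distributed_def)
  define Y where "Y x = ln (\<Prod>k<n. \<bar>x k\<bar>) - mu_H n" for x :: "nat \<Rightarrow> real"
  have Y[measurable]: "Y \<in> borel_measurable ?P" unfolding Y_def by measurable
  have XY: "X \<omega> = Y (\<Lambda> \<omega>)" if "\<omega> \<in> space M" for \<omega>
    using cmod_det_eq_prod_eigenvalues[OF carr[OF that] cp[OF that]] by (simp add: X_def Y_def X_H_def)
  show X: "X \<in> borel_measurable M"
    using measurable_compose[OF \<Lambda> Y] XY by (simp cong: measurable_cong)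
  then show "real_distribution (distr M borel X)" by (rule real_distribution_distr)
  have gw[measurable]: "gue_eigen_weight n \<in> borel_measurable ?P"
    unfolding gue_eigen_weight_def by measurable
  have gw_nonneg: "gue_eigen_weight n x \<ge> 0" for x
    unfolding gue_eigen_weight_def by (intro mult_nonneg_nonneg prod_nonneg) auto
  define Z where "Z t = (\<integral>x. complex_of_real (gue_eigen_weight n x) * (\<Prod>k<n. iexp (t * ln \<bar>x k\<bar>)) \<partial>?P)" for t
  have Z_ratio: "Z t = (\<Prod>k\<in>{1..n}. chi_char (k div 2) t) * Z 0" for t
    unfolding Z_def has_bochner_integral_integral_eq[OF has_integral_eigen_weight_mellin(1)]
    by (rule has_integral_eigen_weight_mellin(2))
  have char_Z: "char (distr M borel X) t = of_real C * exp (- (\<i> * of_real (t * mu_H n))) * Z t" for t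
  proof -
    have "char (distr M borel X) t = (\<integral>\<omega>. iexp (t * X \<omega>) \<partial>M)"
      unfolding char_def by (subst integral_distr) (use X in auto)
    also have "\<dots> = (\<integral>\<omega>. iexp (t * Y (\<Lambda> \<omega>)) \<partial>M)"
      by (intro Bochner_Integration.integral_cong) (simp_all add: XY)
    also have "\<dots> = (\<integral>x. iexp (t * Y x) \<partial>distr M ?P \<Lambda>)"
      by (subst integral_distr) auto
    also have "\<dots> = (\<integral>x. (C * gue_eigen_weight n x) *\<^sub>R iexp (t * Y x) \<partial>?P)"
      unfolding law using C gw_nonneg by (subst integral_density) auto
    also have "\<dots> = (\<integral>x. of_real C * exp (- (\<i> * of_real (t * mu_H n))) *
        (complex_of_real (gue_eigen_weight n x) * (\<Prod>k<n. iexp (t * ln \<bar>x k\<bar>))) \<partial>?P)"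
    proof (rule integral_cong_AE)
      have "AE x in ?P. \<forall>k\<in>{..<n}. x k \<noteq> 0"
        by (rule AE_finite_allI) (auto intro: AE_PiM_lborel_nonzero)
      then show "AE x in ?P. (C * gue_eigen_weight n x) *\<^sub>R iexp (t * Y x) =
          of_real C * exp (- (\<i> * of_real (t * mu_H n))) *
            (complex_of_real (gue_eigen_weight n x) * (\<Prod>k<n. iexp (t * ln \<bar>x k\<bar>)))"
      proof eventually_elim
        case (elim x)
        have "ln (\<Prod>k<n. \<bar>x k\<bar>) = (\<Sum>k<n. ln \<bar>x k\<bar>)"
          using elim by (intro ln_prod) auto
        then have "iexp (t * Y x) = exp (- (\<i> * of_real (t * mu_H n)) + (\<Sum>k<n. \<i> * of_real (t * ln \<bar>x k\<bar>)))"
          by (simp add: Y_def algebra_simps sum_distrib_left)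
        also have "\<dots> = exp (- (\<i> * of_real (t * mu_H n))) * (\<Prod>k<n. iexp (t * ln \<bar>x k\<bar>))"
          by (simp only: exp_add exp_sum finite_lessThan)
        finally show ?case by (simp add: scaleR_conv_of_real)
      qed
    qed measurable
    also have "\<dots> = of_real C * exp (- (\<i> * of_real (t * mu_H n))) * Z t"
      by (simp add: Z_def)
    finally show ?thesis .
  qed
  have "of_real C * Z 0 = 1"
  proof -
    interpret N: real_distribution "distr M borel X" by (rule real_distribution_distr[OF X])
    show ?thesis using char_Z[of 0] N.char_zero by simp
  qed
  then show "char (distr M borel X) t = exp (- (\<i> * of_real (t * mu_H n))) * (\<Prod>k\<in>{1..n}. chi_char (k div 2) t)"
    unfolding char_Z Z_ratio[of t] by (simp add: mult_ac)
qed

section \<open>The determinant in shrinking intervals\<close>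

theorem theorem4p12:
  fixes M :: "nat \<Rightarrow> 'a measure"
    and W :: "nat \<Rightarrow> 'a \<Rightarrow> complex mat"
    and a b \<delta> :: real
  assumes "\<And>n. n \<ge> 1 \<Longrightarrow> normalized_gue n (M n) (W n)"
    and "a < b"
    and "- 1/2 < \<delta>" and "\<delta> < 1"
  shows "(\<lambda>n. (1/2 * ln (real n / 2)) powr (\<delta> + 1/2) *
            measure (M n) {\<omega> \<in> space (M n).
              X_H n (W n \<omega>) \<in> scaled_interval ((2 / ln (real n / 2)) powr \<delta>) a b})
          \<longlonglongrightarrow> (b - a) / sqrt (2 * pi)"
proof -
  define N where "N n = distr (M n) borel (\<lambda>\<omega>. X_H n (W n \<omega>))" for n
  define v where "v n = 1/2 * ln (real n / 2)" for n
  define s where "s n = sqrt (v n)" for n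
  define \<epsilon> where "\<epsilon> n = (2 / ln (real n / 2)) powr \<delta>" for n
  have v_top: "filterlim v at_top sequentially" unfolding v_def by real_asymp
  then have v_pos: "\<forall>\<^sub>F n in sequentially. v n > 0" by (simp add: filterlim_at_top_dense)
  have s_over_eps: "s n / \<epsilon> n = v n powr (\<delta> + 1/2)" if "v n > 0" for n
  proof -
    have "2 / ln (real n / 2) = inverse (v n)" by (simp add: v_def inverse_eq_divide)
    then have "\<epsilon> n = v n powr (- \<delta>)"
      using that by (simp add: \<epsilon>_def powr_minus inverse_powr)
    moreover have "s n = v n powr (1/2)"
      using that by (simp add: s_def powr_half_sqrt)
    ultimately have "s n / \<epsilon> n = v n powr (1/2 - (- \<delta>))"
      by (simp only: powr_diff)
    then show ?thesis by (simp add: add.commute)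
  qed
  have law: "char (N n) t = exp (- (\<i> * of_real (t * mu_H n))) * (\<Prod>k\<in>{1..n}. chi_char (k div 2) t)"
      "real_distribution (N n)" if "n \<ge> 1" for n t
    using normalized_gue_law[OF assms(1)[OF that]] by (simp_all add: N_def)
  have "(\<lambda>n. s n / \<epsilon> n * measure (N n) {\<epsilon> n * a<..<\<epsilon> n * b}) \<longlonglongrightarrow> (b - a) / sqrt (2 * pi)"
  proof (rule local_limit_theorem[where g = "\<lambda>u. inverse (1 + (u / 6)\<^sup>2)"])
    show "\<forall>\<^sub>F n in sequentially. real_distribution (N n)"
      using eventually_ge_at_top[of 1] by eventually_elim (rule law(2))
    show "\<forall>\<^sub>F n in sequentially. s n > 0"
      using v_pos by eventually_elim (simp add: s_def)
    show "\<forall>\<^sub>F n in sequentially. \<epsilon> n > 0"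
      using v_pos by eventually_elim (auto simp: \<epsilon>_def v_def)
    show "(\<lambda>n. \<epsilon> n / s n) \<longlonglongrightarrow> 0"
    proof (rule Lim_transform_eventually)
      show "(\<lambda>n. v n powr (- (\<delta> + 1/2))) \<longlonglongrightarrow> 0"
        using assms(3) by (intro tendsto_neg_powr v_top) simp
      show "\<forall>\<^sub>F n in sequentially. v n powr (- (\<delta> + 1/2)) = \<epsilon> n / s n"
        using v_pos
      proof eventually_elim
        case (elim n)
        have "v n powr (- (\<delta> + 1/2)) = inverse (s n / \<epsilon> n)"
          by (simp only: powr_minus s_over_eps[OF elim])
        then show ?case by simp
      qed
    qed
    show "(\<lambda>n. char (N n) (u / s n)) \<longlonglongrightarrow> of_real (exp (- (u\<^sup>2 / 2)))" for u
    proof (rule Lim_transform_eventually[OF normalized_char_tendsto_gaussian])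
      show "\<forall>\<^sub>F n in sequentially. exp (- (\<i> * of_real (u / sqrt (1/2 * ln (real n / 2)) * mu_H n))) *
          (\<Prod>k\<in>{1..n}. chi_char (k div 2) (u / sqrt (1/2 * ln (real n / 2)))) = char (N n) (u / s n)"
        using eventually_ge_at_top[of 1] by eventually_elim (simp only: law s_def v_def)
    qed
    show "\<forall>\<^sub>F n in sequentially. \<forall>u. norm (char (N n) (u / s n)) \<le> inverse (1 + (u / 6)\<^sup>2)"
      using eventually_ge_at_top[of 1] normalized_char_dominated
      by eventually_elim (simp only: law s_def v_def, simp)
  qed (use assms(2) integrable_inverse_one_plus_square_scaled in auto)
  moreover have "\<forall>\<^sub>F n in sequentially. s n / \<epsilon> n * measure (N n) {\<epsilon> n * a<..<\<epsilon> n * b} =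
      (1/2 * ln (real n / 2)) powr (\<delta> + 1/2) * measure (M n) {\<omega> \<in> space (M n).
        X_H n (W n \<omega>) \<in> scaled_interval ((2 / ln (real n / 2)) powr \<delta>) a b}"
    using v_pos eventually_ge_at_top[of 1]
  proof eventually_elim
    case (elim n)
    have "measure (N n) {\<epsilon> n * a<..<\<epsilon> n * b} = measure (M n) {\<omega> \<in> space (M n).
        X_H n (W n \<omega>) \<in> scaled_interval ((2 / ln (real n / 2)) powr \<delta>) a b}"
      unfolding N_def using normalized_gue_law(1)[OF assms(1)[OF elim(2)]]
      by (subst measure_distr) (auto simp: scaled_interval_def \<epsilon>_def intro!: arg_cong[where f = "measure (M n)"])
    then show ?case using s_over_eps[OF elim(1)] by (simp add: v_def)
  qed
  ultimately show ?thesis by (rule Lim_transform_eventually)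
qed

end
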